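(* Let $K,N\in\mathbb{N}$ be positive integers and $M>0$ a real number, all fixed, and let $\zeta_K=e^{2\pi i/K}$. Suppose that $F(q)$ is analytic for $q=e^{-z}$ where $z=x+iy\in\mathbb{C}$ satisfies $x>0$ and $|y|<\pi$, that $F(q)$ has an expansion $F(q)=\sum_{n=0}^\infty c(n)q^n$ near $1$, and that $F(\zeta_K q)=F(q)$. Suppose further that there are $A\in\mathbb{R}^+$, $B\in\mathbb{R}^+$, $\kappa\in\mathbb{R}^+$ and $\alpha_0,\dots,\alpha_{N-1}\in\mathbb{C}$ such that: (1) (major arc) as $z\to 0$ in the bounded cone $|y|\le Mx$, $$F(e^{-z})=z^B e^{\frac{A}{z}}\left(\sum_{j=0}^{N-1}\alpha_j z^j+O_M(|z|^N)\right);$$ (2) (minor arc) as $x\to0^+$, for $z=x+iy$ in the region $Mx\le y\le \frac{2\pi}{K}-Mx$ (uniformly in $y$), $$|F(e^{-z})|\ll_M e^{\frac{1}{\operatorname{Re}(z)}(A-\kappa)}.$$ Define $C(n)=c(Kn)$, and assume that $\{C(n)\}$ is a sequence of real numbers. Then for each fixed $d\ge1$, the Jensen polynomial $J_C^{d,n}(X)$ is hyperbolic for all but finitely many $n$. Moreover, up to normalization, the Jensen polynomials $J_C^{d,n}(X)$ converge to the Hermite polynomial $H_d(X)$ uniformly over compact subsets of $\mathbb{R}$ as $n\to\infty$; that is, for each fixed $d\geq 1$ there are sequences of positive real numbers $\{A(n)\}$ and $\{\delta(n)\}$ with $\delta(n)\to0$ such that $C(n)\ne0$ for all sufficiently large $n$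 and $$\frac{\delta(n)^{-d}}{C(n)}\,J_C^{d,n}\left(\frac{\delta(n)X-1}{\exp(A(n))}\right)\longrightarrow H_d(X)\qquad (n\to\infty)$$ uniformly in $X$ on every compact subset of $\mathbb{R}$.
   Context: For a sequence of real numbers $\{\alpha(n)\}$, the Jensen polynomial of degree $d$ and shift $n$ is $J_\alpha^{d,n}(X)=\sum_{j=0}^d\binom{d}{j}\alpha(n+j)X^j$. A polynomial is hyperbolic if every zero of it is a real number. The Hermite polynomials $H_d(X)$ are normalized by the generating function $e^{-t^2+Xt}=\sum_{d=0}^\infty H_d(X)\frac{t^d}{d!}$. The power $z^B$ is taken with the principal branch. $O_M$ and $\ll_M$ mean that the implied constants may depend on $M$.
   Formalization: It is additionally assumed that at least one of α_0,…,α_{N-1} is nonzero; without this, F = 0 with all α_j = 0 satisfies every hypothesis while C(n) = 0 for all n, so the claim fails. *)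

theory Defs
  imports "HOL-Complex_Analysis.Complex_Analysis" "HOL-Library.Landau_Symbols"
begin

definition jensen_poly :: "(nat \<Rightarrow> real) \<Rightarrow> nat \<Rightarrow> nat \<Rightarrow> real poly" where
  "jensen_poly \<alpha> d n = (\<Sum>j\<le>d. monom (real (d choose j) * \<alpha> (n + j)) j)"

definition hyperbolic :: "real poly \<Rightarrow> bool" where
  "hyperbolic p \<longleftrightarrow> (\<forall>z::complex. poly (map_poly of_real p) z = 0 \<longrightarrow> z \<in> \<real>)"

text \<open>
  The value at \<open>X\<close> of the Hermite polynomial \<open>H\<^sub>d\<close>, i.e. \<open>d!\<close> times the coefficient of
  \<open>t\<^sup>d\<close> in the formal power series \<open>exp (X t - t\<^sup>2)\<close>. In this normalization \<open>H\<^sub>d\<close> is monic.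
\<close>
definition hermite :: "nat \<Rightarrow> real \<Rightarrow> real" where
  "hermite d X = fact d * fps_nth (fps_exp 1 oo (fps_const X * fps_X - fps_X ^ 2)) d"

lemma hermite_generating_function:
  "(\<lambda>d. hermite d X * t ^ d / fact d) sums (exp (- (t ^ 2) + X * t))"
proof -
  define G where "G = (fps_const X * fps_X - fps_X ^ 2 :: real fps)"
  define H where "H = (fps_const (of_real X) * fps_X - fps_X ^ 2 :: complex fps)"
  have pow: "fps_nth (H ^ i) n = of_real (fps_nth (G ^ i) n)" for i n
  proof (induction i arbitrary: n)
    case (Suc i)
    have "fps_nth H k = of_real (fps_nth G k)" for k
      by (simp add: G_def H_def fps_X_power_iff)
    with Suc show ?case
      by (simp add: fps_mult_nth)
  qed auto
  have nth: "fps_nth (fps_exp 1 oo H) n = of_real (hermite n X / fact n)" for n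
    by (simp add: hermite_def fps_compose_nth pow flip: G_def)
  have "(\<lambda>z. of_real X * z - z ^ 2) has_fps_expansion H"
    unfolding H_def by (intro fps_expansion_intros)
  then have "(exp \<circ> (\<lambda>z. of_real X * z - z ^ 2)) has_fps_expansion (fps_exp 1 oo H)"
    by (intro has_fps_expansion_compose has_fps_expansion_exp1) (auto simp: H_def)
  then have "(\<lambda>n. fps_nth (fps_exp 1 oo H) n * of_real t ^ n) sums
      (exp \<circ> (\<lambda>z. of_real X * z - z ^ 2)) (of_real t)"
    by (rule has_fps_expansion_imp_sums_complex[where r = \<infinity>])
       (auto simp: o_def intro!: holomorphic_intros)
  then have "(\<lambda>n. complex_of_real (hermite n X / fact n * t ^ n)) sums
      complex_of_real (exp (X * t - t ^ 2))"
    by (simp add: nth flip: exp_of_real)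
  then show ?thesis
    unfolding sums_of_real_iff by (simp add: algebra_simps)
qed

text \<open>The points \<open>q = e\<^sup>-\<^sup>z\<close> with \<open>Re z > 0\<close> and \<open>\<bar>Im z\<bar> < \<pi>\<close>.\<close>
definition slit_disc :: "complex set" where
  "slit_disc = (\<lambda>z. exp (- z)) ` {z. Re z > 0 \<and> \<bar>Im z\<bar> < pi}"

definition major_cone :: "real \<Rightarrow> complex set" where
  "major_cone M = {z. Re z > 0 \<and> \<bar>Im z\<bar> \<le> M * Re z}"

end

theory Submission
  imports Defs "HOL-Computational_Algebra.Computational_Algebra" "HOL-Probability.Sinc_Integral"
    "HOL-Probability.Characteristic_Functions"
    "HOL-Real_Asymp.Real_Asymp"
begin

text \<open>
  The Jensen polynomials of \<open>C\<close> are integrals of a single power against a peak that becomes Gaussian, and the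
  Gaussian average of \<open>(X - \<i> s)\<^sup>d\<close> is the Hermite polynomial.

  Put \<open>w = K z\<close>. The invariance of \<open>F\<close> under rotation by \<open>2 \<pi>/K\<close> leaves only the coefficients \<open>c(K n) = C(n)\<close>, so that
  \<open>G(w) = F(exp (- w/K))\<close> is the series \<open>\<Sum>n. C(n) exp (- n w)\<close>; with \<open>\<alpha>\<^sub>k\<close> the first nonzero coefficient of the
  expansion, \<open>G(w)\<close> is asymptotic to a constant times \<open>w\<^sup>b exp (A'/w)\<close> in the cone, where \<open>b = B + k\<close> and \<open>A' = K A\<close>. Choose
  \<open>u = sqrt (A'/n)\<close>, the saddle point of \<open>A'/w + n w\<close>, and integrate along \<open>w = u + \<i> v\<close>, \<open>\<bar>v\<bar> < \<pi>\<close>. Since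
  \<open>2 \<pi> C(n + j) e\<^sup>-\<^sup>u\<^sup>j\<close> is the integral of \<open>G(w) exp (n w) e\<^sup>i\<^sup>j\<^sup>v\<close>, the binomial theorem gives
  (\<open>jensen_poly_peak_integrals\<close>) that
  \<open>2 \<pi> J((\<delta> X - 1)/e\<^sup>u)\<close> is the integral of \<open>G(w) exp (n w) ((1 - e\<^sup>i\<^sup>v) + \<delta> X e\<^sup>i\<^sup>v)\<^sup>d\<close>.

  Now let \<open>\<delta>\<^sup>2 = u\<^sup>3/(4 A')\<close> and \<open>v = \<delta> s\<close>. The exact identity \<open>A'/w + n w - 2 A'/u = - (s\<^sup>2/4) (u/w)\<close> makes the peak
  \<open>G(w) exp (n w)\<close>, divided by its size, converge to \<open>exp (- s\<^sup>2/4)\<close>, while \<open>\<delta>\<^sup>-\<^sup>d\<close> times the power converges to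
  \<open>(X - \<i> s)\<^sup>d\<close>. In the cone there is a Gaussian majorant, on the rest of the line the integrand is exponentially small,
  and dominated convergence applies (\<open>saddle_point_limit\<close>). The limit is Hermite's polynomial because the moments of
  \<open>- \<i> s\<close> for a normal \<open>s\<close> of variance \<open>2\<close> have the generating function \<open>exp (- t\<^sup>2)\<close> (\<open>gaussian_moment_hermite\<close>,
  \<open>hermite_binomial\<close>). Dividing by the case \<open>d = 0\<close>, which is \<open>C(n)\<close>, removes the size of the peak. This is
  convergence of each coefficient of a polynomial of degree at most \<open>d\<close>, hence locally uniform convergence.

  Finally \<open>H\<^sub>d\<close> has \<open>d\<close> distinct real zeros: \<open>H\<^sub>d\<^sub>+\<^sub>1 = X H\<^sub>d - 2 H\<^sub>d'\<close>, and \<open>p \<mapsto> X p - 2 p'\<close> preserves real-rootedness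
  because \<open>p'/p\<close> maps the upper half-plane to the closed lower one when \<open>p\<close> has only real zeros; the zeros are simple
  because \<open>H\<^sub>d' = d H\<^sub>d\<^sub>-\<^sub>1\<close> (\<open>hermite_poly_simple_root\<close>). Each zero is a sign change that persists in the
  approximating polynomials (\<open>sign_changes_imp_many_roots\<close>), so for large \<open>n\<close> the Jensen polynomial has \<open>d\<close> real
  zeros, which are all it can have.
\<close>

section \<open>Hermite polynomials\<close>

fun hermite_poly :: "nat \<Rightarrow> 'a :: field_char_0 poly" where
  "hermite_poly 0 = 1"
| "hermite_poly (Suc 0) = [:0, 1:]"
| "hermite_poly (Suc (Suc n)) =
     pCons 0 (hermite_poly (Suc n)) - smult (2 * of_nat (Suc n)) (hermite_poly n)"

text \<open>
  The series \<open>exp (X t - t\<^sup>2)\<close> is the solution of \<open>G' = (X - 2 t) G\<close> with \<open>G(0) = 1\<close>, and comparing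
  coefficients in this equation is exactly the three-term recurrence. Stating this for an arbitrary
  solution makes it possible to recognise the product \<open>exp (X t) * exp (- t\<^sup>2)\<close> as well.
\<close>
lemma fps_nth_hermite_ode:
  fixes G :: "real fps"
  assumes "fps_nth G 0 = 1"
    and ode: "fps_deriv G = (fps_const X - fps_const 2 * fps_X) * G"
  shows "fact n * fps_nth G n = poly (hermite_poly n) X"
proof (induction n rule: hermite_poly.induct)
  case 2
  have "fps_nth (fps_deriv G) 0 = X * fps_nth G 0"
    by (subst ode) (simp add: algebra_simps)
  then show ?case
    using assms(1) by simp
next
  case (3 n)
  have "of_nat (n + 2) * fps_nth G (n + 2) = fps_nth (fps_deriv G) (Suc n)"
    by simp
  also have "\<dots> = X * fps_nth G (Suc n) - 2 * fps_nth G n"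
    by (subst ode) (simp add: algebra_simps)
  finally have rec: "of_nat (n + 2) * fps_nth G (n + 2) = X * fps_nth G (Suc n) - 2 * fps_nth G n" .
  have "fact (n + 2) * fps_nth G (n + 2) = fact (Suc n) * (of_nat (n + 2) * fps_nth G (n + 2))"
    by simp
  also have "\<dots> = X * (fact (Suc n) * fps_nth G (Suc n)) - 2 * of_nat (Suc n) * (fact n * fps_nth G n)"
    unfolding rec by (simp add: algebra_simps)
  finally have "fact (n + 2) * fps_nth G (n + 2)
      = X * (fact (Suc n) * fps_nth G (Suc n)) - 2 * of_nat (Suc n) * (fact n * fps_nth G n)" .
  then show ?case
    using 3 by simp
qed (use assms in auto)

lemma hermite_eq_poly: "hermite n X = poly (hermite_poly n) X"
proof -
  define g where "g = fps_const X * fps_X - fps_X ^ 2"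
  have g0: "fps_nth g 0 = 0"
    by (simp add: g_def)
  have "fps_deriv g = fps_const X - fps_const 2 * fps_X"
    by (simp add: g_def fps_deriv_power numeral_fps_const)
  then have "fps_deriv (fps_exp 1 oo g) = (fps_const X - fps_const 2 * fps_X) * (fps_exp 1 oo g)"
    using fps_compose_deriv[OF g0, of "fps_exp 1"] by (simp add: mult.commute)
  then show ?thesis
    unfolding hermite_def g_def[symmetric] by (intro fps_nth_hermite_ode) simp_all
qed

text \<open>
  Cauchy product of \<open>exp (X t)\<close> and \<open>exp (- t\<^sup>2)\<close>. The values at \<open>0\<close> that occur here will reappear as the
  moments of the Gaussian limit.
\<close>
lemma hermite_binomial:
  "hermite d X = (\<Sum>k\<le>d. of_nat (d choose k) * hermite (d - k) 0 * X ^ k)"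
proof -
  define E where "E = fps_exp 1 oo (fps_const 0 * fps_X - fps_X ^ 2 :: real fps)"
  define G where "G = fps_exp X * E"
  have "fps_deriv E = - (fps_const 2 * fps_X * E)"
    using fps_compose_deriv[of "fps_const 0 * fps_X - fps_X ^ 2 :: real fps" "fps_exp 1"]
    by (simp add: E_def fps_deriv_power numeral_fps_const mult_ac)
  then have "fps_deriv G = (fps_const X - fps_const 2 * fps_X) * G"
    by (simp add: G_def algebra_simps)
  then have "hermite d X = fact d * fps_nth G d"
    by (subst fps_nth_hermite_ode) (simp_all add: G_def E_def hermite_eq_poly)
  also have "\<dots> = (\<Sum>k\<le>d. fact d * (X ^ k / fact k * fps_nth E (d - k)))"
    by (simp add: G_def fps_mult_nth sum_distrib_left atLeast0AtMost)
  also have "\<dots> = (\<Sum>k\<le>d. of_nat (d choose k) * hermite (d - k) 0 * X ^ k)"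
    by (intro sum.cong refl) (simp add: hermite_def E_def binomial_fact)
  finally show ?thesis .
qed

lemma hermite_0_rec: "hermite (Suc (Suc n)) 0 = - 2 * of_nat (Suc n) * hermite n 0"
  by (simp add: hermite_eq_poly algebra_simps)

lemma hermite_0_0: "hermite 0 0 = 1"
  by (simp add: hermite_eq_poly)

lemma hermite_0_odd: "hermite (2 * l + 1) 0 = 0"
proof (induction l)
  case (Suc l)
  then show ?case
    using hermite_0_rec[of "2 * l + 1"] by simp
qed (simp add: hermite_eq_poly)

lemma hermite_0_even: "hermite (2 * l) 0 = (- 1) ^ l * fact (2 * l) / fact l"
proof (induction l)
  case (Suc l)
  have "hermite (2 * Suc l) 0 = - 2 * of_nat (Suc (2 * l)) * ((- 1) ^ l * fact (2 * l) / fact l)"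
    using hermite_0_rec[of "2 * l"] Suc by simp
  also have "\<dots> = (- 1) ^ Suc l * (2 * of_nat (Suc l) * of_nat (Suc (2 * l)) * fact (2 * l))
      / (of_nat (Suc l) * fact l)"
    by (simp del: of_nat_Suc)
  also have "\<dots> = (- 1) ^ Suc l * fact (2 * Suc l) / fact (Suc l)"
    by (simp add: algebra_simps)
  finally show ?case .
qed (simp add: hermite_eq_poly)

lemma pderiv_hermite_poly:
  "pderiv (hermite_poly (Suc n) :: 'a :: field_char_0 poly) = smult (of_nat (Suc n)) (hermite_poly n)"
proof (induction n rule: hermite_poly.induct)
  case (3 n)
  have "pderiv (hermite_poly (Suc (Suc (Suc n))) :: 'a poly)
      = hermite_poly (Suc (Suc n)) + pCons 0 (pderiv (hermite_poly (Suc (Suc n))))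
        - smult (2 * of_nat (Suc (Suc n))) (pderiv (hermite_poly (Suc n)))"
    by (simp only: hermite_poly.simps(3)[of "Suc n"] pderiv_diff pderiv_smult pderiv_pCons)
  also have "\<dots> = hermite_poly (Suc (Suc n)) + smult (of_nat (Suc (Suc n)))
      (pCons 0 (hermite_poly (Suc n)) - smult (2 * of_nat (Suc n)) (hermite_poly n))"
    unfolding 3 by (rule poly_eqI) (simp add: coeff_pCons algebra_simps del: hermite_poly.simps split: nat.split)
  also have "\<dots> = smult (of_nat (Suc (Suc (Suc n)))) (hermite_poly (Suc (Suc n)))"
    unfolding hermite_poly.simps(3)[symmetric]
    by (simp only: of_nat_Suc[of "Suc (Suc n)"] smult_add_left smult_1_left)
  finally show ?case .
qed (auto simp: pderiv_pCons pderiv_1 one_pCons)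

text \<open>
  \<open>p \<mapsto> X p - 2 p'\<close> is the raising operator of the Hermite family; it is \<open>- 2 exp (X\<^sup>2/4)\<close> times the
  derivative of \<open>p exp (- X\<^sup>2/4)\<close>, and it preserves real-rootedness.
\<close>
lemma hermite_poly_Suc:
  "hermite_poly (Suc n) = pCons 0 (hermite_poly n) - smult 2 (pderiv (hermite_poly n))"
proof (cases n)
  case (Suc m)
  then show ?thesis
    by (simp add: pderiv_hermite_poly del: of_nat_Suc)
qed (simp add: pderiv_1 one_pCons)

lemma degree_hermite_poly:
  "degree (hermite_poly n :: 'a :: field_char_0 poly) = n \<and> coeff (hermite_poly n :: 'a poly) n = 1"
proof -
  have "degree (hermite_poly n :: 'a poly) \<le> n \<and> coeff (hermite_poly n :: 'a poly) n = 1"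
  proof (induction n rule: hermite_poly.induct)
    case (3 n)
    then show ?case
      by (auto intro!: degree_diff_le simp: degree_pCons_eq_if coeff_eq_0)
  qed auto
  then show ?thesis
    using le_degree[of "hermite_poly n :: 'a poly" n] by auto
qed

text \<open>
  At a common zero of \<open>H\<^sub>n\<close> and \<open>H\<^sub>n'\<close> also \<open>H\<^sub>n\<^sub>-\<^sub>1\<close> vanishes, because \<open>H\<^sub>n' = n H\<^sub>n\<^sub>-\<^sub>1\<close>, and by the raising
  operator \<open>H\<^sub>n\<^sub>-\<^sub>1'\<close> vanishes too; descending, one reaches the contradiction \<open>H\<^sub>0 = 0\<close>.
\<close>
lemma hermite_poly_simple_root:
  "poly (hermite_poly n) x = 0 \<Longrightarrow> poly (pderiv (hermite_poly n)) x \<noteq> 0"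
proof (induction n)
  case (Suc n)
  then show ?case
    unfolding pderiv_hermite_poly
    by (auto simp: hermite_poly_Suc[of n] simp del: hermite_poly.simps of_nat_Suc)
qed auto

text \<open>
  \<open>p'/p\<close> is the sum of the \<open>1/(z - r)\<close>, and each summand maps the upper half-plane to the lower one when
  \<open>r\<close> is real.
\<close>
lemma log_derivative_prod_real_roots:
  fixes z :: complex
  assumes "Im z > 0" "\<forall>r\<in>#R. Im r = 0"
  defines "p \<equiv> (\<Prod>r\<in>#R. [:- r, 1:])"
  shows "poly p z \<noteq> 0 \<and> Im (poly (pderiv p) z / poly p z) \<le> 0"
  using assms(2) unfolding p_def
proof (induction R)
  case (add r R)
  define q where "q = (\<Prod>r\<in>#R. [:- r, 1:])"
  have q: "poly q z \<noteq> 0" "Im (poly (pderiv q) z / poly q z) \<le> 0"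
    using add by (auto simp: q_def)
  have r: "z - r \<noteq> 0" "Im (z - r) > 0"
    using add assms(1) by auto
  have "poly (pderiv ([:- r, 1:] * q)) z / poly ([:- r, 1:] * q) z
      = poly (pderiv q) z / poly q z + 1 / (z - r)"
    unfolding pderiv_mult using q r by (simp add: pderiv_pCons field_simps)
  moreover have "Im (1 / (z - r)) \<le> 0"
    using r by (simp add: Im_divide divide_nonpos_nonneg)
  ultimately have "Im (poly (pderiv ([:- r, 1:] * q)) z / poly ([:- r, 1:] * q) z) \<le> 0"
    using q by simp
  then show ?case
    using q r by (simp add: q_def)
qed auto

text \<open>
  A zero \<open>z\<close> of \<open>X p - 2 p'\<close> in the upper half-plane would satisfy \<open>z = 2 p'(z)/p(z)\<close>, with a right-hand
  side of nonpositive imaginary part. Only one half-plane is treated here; for Hermite polynomials the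
  other one follows by complex conjugation.
\<close>
lemma hermite_operator_real_rooted:
  fixes p :: "complex poly"
  assumes "p \<noteq> 0" and roots: "\<And>z. poly p z = 0 \<Longrightarrow> Im z = 0"
    and z: "poly (pCons 0 p - smult 2 (pderiv p)) z = 0"
  shows "Im z \<le> 0"
proof (rule ccontr)
  assume "\<not> Im z \<le> 0"
  then have pos: "Im z > 0"
    by simp
  obtain c R where R: "p = smult c (\<Prod>r\<in>#R. [:- r, 1:])"
    using complex_poly_decompose_multiset[of p] by metis
  define q where "q = (\<Prod>r\<in>#R. [:- r, 1:])"
  have pq: "p = smult c q" and lc: "c \<noteq> 0"
    using R assms(1) by (auto simp: q_def)
  have "Im r = 0" if "r \<in># R" for r
  proof (rule roots)
    show "poly p r = 0"
      using that by (subst R) (auto simp: poly_prod_mset)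
  qed
  then have q: "poly q z \<noteq> 0" "Im (poly (pderiv q) z / poly q z) \<le> 0"
    using log_derivative_prod_real_roots[OF pos] unfolding q_def by blast+
  have "poly (smult c (pCons 0 q - smult 2 (pderiv q))) z = 0"
    using z by (simp add: pq pderiv_smult algebra_simps)
  then have "z * poly q z = 2 * poly (pderiv q) z"
    using lc by simp
  then have "z = 2 * (poly (pderiv q) z / poly q z)"
    using q by (simp add: field_simps)
  then have "Im z = Im (2 * (poly (pderiv q) z / poly q z))"
    by simp
  then have "Im z = 2 * Im (poly (pderiv q) z / poly q z)"
    by (simp only: times_complex.sel complex_Re_numeral complex_Im_numeral)
  then show False
    using q pos by linarith
qed

lemma poly_hermite_poly_cnj:
  "poly (hermite_poly n) (cnj z) = cnj (poly (hermite_poly n) z)"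
  by (induction n rule: hermite_poly.induct) simp_all

lemma poly_hermite_poly_of_real:
  "poly (hermite_poly n) (complex_of_real x) = complex_of_real (poly (hermite_poly n) x)"
  by (induction n rule: hermite_poly.induct) simp_all

lemma hermite_poly_complex_roots_real:
  "poly (hermite_poly n) z = 0 \<Longrightarrow> Im z = 0"
proof (induction n arbitrary: z)
  case (Suc n)
  have nz: "hermite_poly n \<noteq> (0 :: complex poly)"
    using degree_hermite_poly[of n, where 'a = complex] by auto
  have "Im w \<le> 0" if "poly (hermite_poly (Suc n)) w = 0" for w :: complex
    using hermite_operator_real_rooted[OF nz Suc.IH] that unfolding hermite_poly_Suc[of n] by blast
  from this[of z] this[of "cnj z"] show ?case
    using Suc.prems by (simp add: poly_hermite_poly_cnj del: hermite_poly.simps)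
qed simp

lemma card_hermite_roots:
  "finite {x. hermite d x = 0} \<and> card {x. hermite d x = 0} = d"
proof -
  define p :: "complex poly" where "p = hermite_poly d"
  have nz: "p \<noteq> 0"
    using degree_hermite_poly[of d, where 'a = complex] by (auto simp: p_def)
  have "smult (lead_coeff p) (\<Prod>z|poly p z = 0. [:- z, 1:]) = p"
    using hermite_poly_simple_root[of d, where 'a = complex]
    by (intro complex_poly_decompose_rsquarefree) (auto simp: rsquarefree_roots p_def)
  then have "degree p = degree (\<Prod>z|poly p z = 0. [:- z, 1:])"
    using nz by (metis degree_smult_eq leading_coeff_0_iff)
  also have "\<dots> = card {z. poly p z = 0}"
    by (simp add: degree_prod_sum_eq)
  finally have "card {z. poly p z = 0} = d"
    using degree_hermite_poly[of d, where 'a = complex] by (simp add: p_def)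
  moreover have "{z. poly p z = 0} = of_real ` {x. hermite d x = 0}"
  proof (intro equalityI subsetI)
    fix z assume "z \<in> {z. poly p z = 0}"
    then have "poly p z = 0" "z = of_real (Re z)"
      using hermite_poly_complex_roots_real[of d z] by (auto simp: p_def complex_eq_iff)
    then show "z \<in> of_real ` {x. hermite d x = 0}"
      by (metis (mono_tags, lifting) hermite_eq_poly image_eqI mem_Collect_eq of_real_eq_0_iff
            p_def poly_hermite_poly_of_real)
  qed (auto simp: p_def hermite_eq_poly poly_hermite_poly_of_real)
  moreover have "finite {z. poly p z = 0}"
    using nz by (rule poly_roots_finite)
  ultimately show ?thesis
    by (auto simp: card_image inj_on_def dest: finite_imageD)
qed

section \<open>Polynomials with only real zeros\<close>

lemma hyperbolicI:
  assumes "degree p \<le> d" "p \<noteq> 0" "card R = d" "finite R" "\<And>x. x \<in> R \<Longrightarrow> poly p x = 0"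
  shows "hyperbolic p"
  unfolding hyperbolic_def
proof (intro allI impI, rule ccontr)
  fix z :: complex
  define q :: "complex poly" where "q = map_poly of_real p"
  have real: "poly (map_poly of_real p) (complex_of_real x) = of_real (poly p x)" for x
    by (induction p) (auto simp: map_poly_pCons)
  assume "poly (map_poly of_real p) z = 0" "z \<notin> \<real>"
  then have "insert z (of_real ` R) \<subseteq> {w. poly q w = 0}"
    using assms(5) by (auto simp: q_def real)
  moreover have q: "q \<noteq> 0" "degree q \<le> d"
    using assms(1,2) by (auto simp: q_def map_poly_eq_0_iff degree_map_poly)
  ultimately have "card (insert z (of_real ` R)) \<le> d"
    using card_mono[OF poly_roots_finite[OF q(1)]] card_poly_roots_bound[OF q(1)] le_trans by metis
  moreover have "card (insert z (complex_of_real ` R)) = Suc d"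
    using \<open>z \<notin> \<real>\<close> assms(3,4) by (subst card_insert_disjoint) (auto simp: card_image inj_on_def)
  ultimately show False
    by simp
qed

text \<open>
  A simple real zero of the limit is a sign change, which is inherited by all late members of the
  sequence; on disjoint neighbourhoods of the zeros the intermediate value theorem gives distinct zeros.
  Pointwise convergence is enough, since only finitely many test points are involved.
\<close>
lemma sign_changes_imp_many_roots:
  fixes f :: "nat \<Rightarrow> real \<Rightarrow> real" and h :: "real poly"
  assumes cont: "\<And>n. continuous_on UNIV (f n)"
    and lim: "\<And>x. (\<lambda>n. f n x) \<longlonglongrightarrow> poly h x"
    and simple: "\<And>x. poly h x = 0 \<Longrightarrow> poly (pderiv h) x \<noteq> 0"
  shows "\<forall>\<^sub>F n in sequentially. \<exists>R. finite R \<and> card R = card {x. poly h x = 0} \<and> (\<forall>x\<in>R. f n x = 0)"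
proof -
  define Z where "Z = {x. poly h x = 0}"
  have "h \<noteq> 0"
    using simple[of 0] by auto
  then have fin: "finite Z"
    unfolding Z_def by (rule poly_roots_finite)
  \<comment> \<open>neighbourhoods of radius at most \<open>e\<close> around different zeros are disjoint; the extra element \<open>1\<close>
    of \<open>D\<close> covers the case of fewer than two zeros\<close>
  obtain e where e: "e > 0" "\<And>x y. x \<in> Z \<Longrightarrow> y \<in> Z \<Longrightarrow> x \<noteq> y \<Longrightarrow> 2 * e < dist x y"
  proof -
    define D where "D = insert 1 ((\<lambda>(x, y). dist x y) ` (Z \<times> Z - Id))"
    have D: "finite D" "D \<noteq> {}" "\<And>t. t \<in> D \<Longrightarrow> t > 0"
      using fin by (auto simp: D_def)
    have "2 * (Min D / 3) < dist x y" if "x \<in> Z" "y \<in> Z" "x \<noteq> y" for x y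
    proof -
      have "Min D \<le> dist x y" "Min D > 0"
        using D that by (auto intro!: Min_le simp: D_def)
      then show ?thesis
        by linarith
    qed
    moreover have "Min D / 3 > 0"
      using D by simp
    ultimately show ?thesis
      using that by blast
  qed
  have "\<exists>\<delta>. 0 < \<delta> \<and> \<delta> \<le> e \<and> poly h (r - \<delta>) * poly h (r + \<delta>) < 0" if "r \<in> Z" for r
  proof -
    have r: "poly h r = 0" and d: "poly (pderiv h) r \<noteq> 0"
      using that simple by (auto simp: Z_def)
    have D: "DERIV (poly h) r :> poly (pderiv h) r"
      by (rule poly_DERIV)
    show ?thesis
    proof (cases "poly (pderiv h) r > 0")
      case True
      obtain d1 where "d1 > 0" "\<And>t. t > 0 \<Longrightarrow> t < d1 \<Longrightarrow> poly h r < poly h (r + t)"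
        using DERIV_pos_inc_right[OF D True] by blast
      moreover obtain d2 where "d2 > 0" "\<And>t. t > 0 \<Longrightarrow> t < d2 \<Longrightarrow> poly h (r - t) < poly h r"
        using DERIV_pos_inc_left[OF D True] by blast
      ultimately show ?thesis
        using e(1) r by (intro exI[of _ "min e (min d1 d2 / 2)"]) (auto intro!: mult_neg_pos)
    next
      case False
      then have neg: "poly (pderiv h) r < 0"
        using d by simp
      obtain d1 where "d1 > 0" "\<And>t. t > 0 \<Longrightarrow> t < d1 \<Longrightarrow> poly h r > poly h (r + t)"
        using DERIV_neg_dec_right[OF D neg] by blast
      moreover obtain d2 where "d2 > 0" "\<And>t. t > 0 \<Longrightarrow> t < d2 \<Longrightarrow> poly h (r - t) > poly h r"
        using DERIV_neg_dec_left[OF D neg] by blast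
      ultimately show ?thesis
        using e(1) r by (intro exI[of _ "min e (min d1 d2 / 2)"]) (auto intro!: mult_pos_neg)
    qed
  qed
  then obtain \<delta> where \<delta>: "\<And>r. r \<in> Z \<Longrightarrow> 0 < \<delta> r \<and> \<delta> r \<le> e \<and> poly h (r - \<delta> r) * poly h (r + \<delta> r) < 0"
    by metis
  have "\<forall>\<^sub>F n in sequentially. \<forall>r\<in>Z. f n (r - \<delta> r) * f n (r + \<delta> r) < 0"
    unfolding eventually_ball_finite_distrib[OF fin]
  proof
    fix r assume "r \<in> Z"
    have "(\<lambda>n. f n (r - \<delta> r) * f n (r + \<delta> r)) \<longlonglongrightarrow> poly h (r - \<delta> r) * poly h (r + \<delta> r)"
      by (intro tendsto_mult lim)
    then show "\<forall>\<^sub>F n in sequentially. f n (r - \<delta> r) * f n (r + \<delta> r) < 0"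
      using \<delta>[OF \<open>r \<in> Z\<close>] by (intro order_tendstoD(2)) auto
  qed
  then show ?thesis
  proof eventually_elim
    case (elim n)
    have "\<exists>x. \<bar>x - r\<bar> \<le> \<delta> r \<and> f n x = 0" if "r \<in> Z" for r
    proof -
      have le: "r - \<delta> r \<le> r + \<delta> r" and neg: "f n (r - \<delta> r) * f n (r + \<delta> r) < 0"
        using \<delta> elim that by (auto simp: less_imp_le add_increasing)
      have cont': "continuous_on {r - \<delta> r..r + \<delta> r} (f n)"
        using cont continuous_on_subset by blast
      have "f n (r - \<delta> r) \<le> 0 \<and> 0 \<le> f n (r + \<delta> r) \<or> f n (r + \<delta> r) \<le> 0 \<and> 0 \<le> f n (r - \<delta> r)"
        using neg by (auto simp: mult_less_0_iff)
      then obtain x where "r - \<delta> r \<le> x" "x \<le> r + \<delta> r" "f n x = 0"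
        using IVT'[of "f n" "r - \<delta> r" 0 "r + \<delta> r"] IVT2'[of "f n" "r + \<delta> r" 0 "r - \<delta> r"] le cont'
        by metis
      then show ?thesis
        by (intro exI[of _ x]) auto
    qed
    then obtain g where g: "\<And>r. r \<in> Z \<Longrightarrow> \<bar>g r - r\<bar> \<le> \<delta> r \<and> f n (g r) = 0"
      by metis
    have "inj_on g Z"
    proof (rule inj_onI, rule ccontr)
      fix x y assume "x \<in> Z" "y \<in> Z" "g x = g y" "x \<noteq> y"
      then have "dist x y \<le> 2 * e"
        using g[of x] g[of y] \<delta>[of x] \<delta>[of y] by (auto simp: dist_real_def)
      then show False
        using e(2)[of x y] \<open>x \<in> Z\<close> \<open>y \<in> Z\<close> \<open>x \<noteq> y\<close> by simp
    qed
    then show ?case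
      using g fin by (intro exI[of _ "g ` Z"]) (auto simp: card_image Z_def)
  qed
qed

section \<open>Gaussian integrals\<close>

text \<open>
  \<open>exp (- s\<^sup>2/4)\<close> is \<open>2 sqrt \<pi>\<close> times the normal density of variance \<open>2\<close>, the variance for which the
  characteristic function is \<open>exp (- t\<^sup>2)\<close>.
\<close>
lemma gaussian_quarter_moment_even:
  "has_bochner_integral lborel (\<lambda>s::real. exp (- s\<^sup>2 / 4) * s ^ (2 * l)) (2 * sqrt pi * fact (2 * l) / fact l)"
proof -
  have "has_bochner_integral lborel (\<lambda>s. 2 * sqrt pi * (normal_density 0 (sqrt 2) s * (s - 0) ^ (2 * l)))
     (2 * sqrt pi * (fact (2 * l) / ((2 / (sqrt 2)\<^sup>2) ^ l * fact l)))"
    by (intro has_bochner_integral_mult_right normal_moment_even) auto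
  then show ?thesis
    by (simp add: normal_density_def real_sqrt_mult)
qed

lemma gaussian_quarter_moment_odd:
  "has_bochner_integral lborel (\<lambda>s::real. exp (- s\<^sup>2 / 4) * s ^ (2 * l + 1)) 0"
proof -
  have "has_bochner_integral lborel (\<lambda>s. 2 * sqrt pi * (normal_density 0 (sqrt 2) s * (s - 0) ^ (2 * l + 1)))
     (2 * sqrt pi * 0)"
    by (intro has_bochner_integral_mult_right normal_moment_odd) auto
  then show ?thesis
    by (simp add: normal_density_def real_sqrt_mult)
qed

lemma integrable_gaussian_moment:
  assumes "a > 0"
  shows "integrable lborel (\<lambda>s::real. exp (- a * s\<^sup>2) * \<bar>s\<bar> ^ m)"
proof -
  have "integrable lborel (\<lambda>s. sqrt (pi / a) * (normal_density 0 (sqrt (1 / (2 * a))) s * \<bar>s - 0\<bar> ^ m))"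
    using assms by (intro integrable_mult_right integrable_normal_moment_abs) auto
  also have "(\<lambda>s. sqrt (pi / a) * (normal_density 0 (sqrt (1 / (2 * a))) s * \<bar>s - 0\<bar> ^ m)) = (\<lambda>s. exp (- a * s\<^sup>2) * \<bar>s\<bar> ^ m)"
    using assms by (auto simp: normal_density_def fun_eq_iff field_simps real_sqrt_divide)
  finally show ?thesis .
qed

lemma integrable_inverse_1_plus_square': "integrable lborel (\<lambda>s::real. inverse (1 + s\<^sup>2))"
  using integrable_inverse_1_plus_square by (simp add: set_integrable_def)

text \<open>
  The probabilistic form of the generating function: for a centred normal \<open>s\<close> of variance \<open>2\<close> the
  expectation of \<open>exp (- \<i> s t)\<close> is \<open>exp (- t\<^sup>2)\<close>, so the moments of \<open>- \<i> s\<close> are the values of the Hermite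
  polynomials at \<open>0\<close>.
\<close>
lemma gaussian_moment_hermite:
  "(\<integral>s. of_real (exp (- s\<^sup>2 / 4)) * (- (\<i> * of_real s)) ^ p \<partial>lborel) = of_real (2 * sqrt pi * hermite p 0)"
proof -
  have eq: "of_real (exp (- s\<^sup>2 / 4)) * (- (\<i> * of_real s)) ^ p = (- \<i>) ^ p * of_real (exp (- s\<^sup>2 / 4) * s ^ p)" for s
    unfolding minus_mult_left power_mult_distrib by simp
  have "(\<integral>s. of_real (exp (- s\<^sup>2 / 4)) * (- (\<i> * of_real s)) ^ p \<partial>lborel)
     = (- \<i>) ^ p * of_real (\<integral>s. exp (- s\<^sup>2 / 4) * s ^ p \<partial>lborel)"
    unfolding eq by (simp only: integral_mult_right_zero integral_complex_of_real)
  also have "\<dots> = of_real (2 * sqrt pi * hermite p 0)"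
  proof (cases "even p")
    case True
    then obtain l where l: "p = 2 * l" ..
    show ?thesis
      unfolding l hermite_0_even has_bochner_integral_integral_eq[OF gaussian_quarter_moment_even]
      by (simp add: power_mult)
  next
    case False
    then obtain l where l: "p = 2 * l + 1"
      by (auto elim: oddE)
    show ?thesis
      unfolding l hermite_0_odd has_bochner_integral_integral_eq[OF gaussian_quarter_moment_odd] by simp
  qed
  finally show ?thesis .
qed

section \<open>The saddle point method\<close>

lemma powr_divide_of_real:
  fixes w :: complex
  assumes "u > 0"
  shows "w powr z / of_real u powr z = (w / of_real u) powr z"
proof -
  have "w powr z = (of_real u * (w / of_real u)) powr z"
    using assms by simp
  also have "\<dots> = of_real u powr z * (w / of_real u) powr z"
    using assms by (intro powr_times_real_left) auto
  finally show ?thesis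
    using assms by simp
qed

text \<open>
  On the minor arc the integrand is smaller than the peak by a factor \<open>exp (- \<kappa>/u)\<close>. This beats every power of
  \<open>1/u\<close>, in particular those that come from the length of the arc measured in units of the peak width
  \<open>sqrt (u\<^sup>3/(4 A))\<close>.
\<close>
lemma super_exponential_decay:
  fixes A \<kappa> b c :: real and m :: nat
  assumes "A > 0" "\<kappa> > 0"
  shows "((\<lambda>u. c * u powr (-b) * exp (-\<kappa>/u) * (1 + pi / sqrt (u^3/(4*A)))^m) \<longlongrightarrow> 0) (at_right 0)"
  using assms by real_asymp

text \<open>
  With \<open>n = A/u\<^sup>2\<close> the exponent \<open>A/w + n w\<close> has its saddle point at \<open>w = u\<close>, and
  \<open>A/w + n w - 2 A/u = A (w - u)\<^sup>2 / (w u\<^sup>2)\<close> holds exactly. On the vertical line \<open>w = u + \<i> \<delta> s\<close> with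
  \<open>\<delta>\<^sup>2 = u\<^sup>3/(4 A)\<close> this is a Gaussian exponent up to the factor \<open>u/w\<close>, which tends to \<open>1\<close>.
\<close>
lemma saddle_exponent:
  fixes w :: complex and A u s \<delta> :: real
  assumes "A > 0" "u > 0" "\<delta>\<^sup>2 = u ^ 3 / (4 * A)" and w: "w = Complex u (\<delta> * s)"
  shows "of_real A / w + of_real (A / u\<^sup>2) * w - of_real (2 * A / u) = - of_real (s\<^sup>2 / 4) * (of_real u / w)"
proof -
  have nz: "w \<noteq> 0" 
    using assms by (auto simp: complex_eq_iff)
  have "(w - of_real u)\<^sup>2 = - of_real (\<delta>\<^sup>2 * s\<^sup>2)"
    by (simp add: w complex_eq_iff power2_eq_square)
  also have "\<dots> = - of_real (u ^ 3 * s\<^sup>2 / (4 * A))"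
    using assms(3) by simp
  finally have "of_real A * (w - of_real u)\<^sup>2 = - of_real (A * (u ^ 3 * s\<^sup>2 / (4 * A)))"
    by simp
  also have "A * (u ^ 3 * s\<^sup>2 / (4 * A)) = u ^ 3 * s\<^sup>2 / 4"
    using assms by simp
  finally have *: "of_real A * (w - of_real u)\<^sup>2 = - of_real (u ^ 3 * s\<^sup>2 / 4)" .
  have "of_real A / w + of_real (A / u\<^sup>2) * w - of_real (2 * A / u)
     = of_real A * (w - of_real u)\<^sup>2 / (w * of_real u ^ 2)"
    using nz assms by (simp add: field_simps power2_eq_square)
  also have "\<dots> = - of_real (s\<^sup>2 / 4) * (of_real u / w)"
    unfolding * using nz assms by (simp add: field_simps power2_eq_square power3_eq_cube)
  finally show ?thesis .
qed

text \<open>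
  Dominated convergence after rescaling the line of integration by the width of the peak. For a fixed
  \<open>s\<close> the point \<open>w = u + \<i> \<delta> s\<close> eventually lies in the cone, since \<open>\<delta>/u\<close> tends to \<open>0\<close>; there the integrand is
  \<open>G(w) / (\<beta> w\<^sup>b exp (A/w)) * (w/u)\<^sup>b * exp (- (s\<^sup>2/4) u/w) * h(s)\<close>, with the limit \<open>exp (- s\<^sup>2/4) h0(s)\<close>.
  The dominating function has a Gaussian part for the cone, where \<open>Re (u/w) \<ge> 1/(1 + M\<^sup>2)\<close>, and the part
  \<open>1/(1 + s\<^sup>2)\<close> for the minor arc.

  The factor \<open>h\<close> of polynomial growth is left open: it will be one of the functions whose integrals are the
  coefficients of a Jensen polynomial.
\<close>
lemma saddle_point_limit:
  fixes G :: "complex \<Rightarrow> complex" and A M \<kappa> b L :: real and \<beta> :: complex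
    and u \<delta> :: "nat \<Rightarrow> real" and h :: "nat \<Rightarrow> real \<Rightarrow> complex" and h0 :: "real \<Rightarrow> complex" and m :: nat
  assumes A: "A > 0" and M: "M > 0" and \<kappa>: "\<kappa> > 0" and b: "b \<ge> 0" and \<beta>: "\<beta> \<noteq> 0"
    and cont: "continuous_on {w. Re w > 0} G"
    and major: "((\<lambda>w. G w / (w powr of_real b * exp (of_real A / w))) \<longlongrightarrow> \<beta>) (at 0 within major_cone M)"
    and minor: "\<forall>\<^sub>F u in at_right 0. \<forall>v. M * u \<le> \<bar>v\<bar> \<and> \<bar>v\<bar> < pi \<longrightarrow>
                  norm (G (Complex u v)) \<le> L * exp ((A - \<kappa>) / u)"
    and u: "\<And>n. u n > 0" "u \<longlonglongrightarrow> 0"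
    and \<delta>_def: "\<And>n. \<delta> n = sqrt (u n ^ 3 / (4 * A))"
    and h_meas: "\<And>n. continuous_on UNIV (h n)"
    and h_bound: "\<And>n s. norm (h n s) \<le> \<bar>s\<bar> ^ m"
    and h_lim: "\<And>s. (\<lambda>n. h n s) \<longlonglongrightarrow> h0 s"
  shows "(\<lambda>n. \<integral>s. (indicator {-pi<..<pi} (\<delta> n * s) *\<^sub>R
              (G (Complex (u n) (\<delta> n * s)) * exp (of_real (A / (u n)\<^sup>2) * Complex (u n) (\<delta> n * s)) * h n s))
            / (\<beta> * of_real (u n powr b * exp (2 * A / u n))) \<partial>lborel)
         \<longlonglongrightarrow> (\<integral>s. of_real (exp (- s\<^sup>2 / 4)) * h0 s \<partial>lborel)"
proof -
  define w where "w n s = Complex (u n) (\<delta> n * s)" for n s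
  define \<Phi> where "\<Phi> w = G w / (w powr of_real b * exp (of_real A / w))" for w
  define g where "g n s = (indicator {-pi<..<pi} (\<delta> n * s) *\<^sub>R
              (G (w n s) * exp (of_real (A / (u n)\<^sup>2) * w n s) * h n s))
            / (\<beta> * of_real (u n powr b * exp (2 * A / u n)))" for n s
  have \<delta>: "\<delta> n > 0" "(\<delta> n)\<^sup>2 = u n ^ 3 / (4 * A)" for n
    using u(1)[of n] A by (simp_all add: \<delta>_def)
  have u_right: "filterlim u (at_right 0) sequentially"
    using u less_imp_neq[OF u(1)] by (auto simp: filterlim_at intro!: always_eventually)
  have \<delta>u: "\<delta> n / u n = sqrt (u n / (4 * A))" for n
  proof -
    have "u n ^ 3 / (4 * A) = (u n)\<^sup>2 * (u n / (4 * A))"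
      by (simp add: power2_eq_square power3_eq_cube)
    then have "\<delta> n = u n * sqrt (u n / (4 * A))"
      unfolding \<delta>_def using u(1)[of n] by (simp only: real_sqrt_mult real_sqrt_abs abs_of_pos)
    then show ?thesis
      using u(1)[of n] by simp
  qed
  have \<delta>u_lim: "(\<lambda>n. \<delta> n / u n) \<longlonglongrightarrow> 0"
    unfolding \<delta>u using u(2) A by (auto intro!: tendsto_eq_intros)
  have \<delta>_lim: "\<delta> \<longlonglongrightarrow> 0"
    unfolding \<delta>_def using u(2) A by (auto intro!: tendsto_eq_intros)
  have w_nz: "w n s \<noteq> 0" for n s
    using u(1)[of n] by (auto simp: w_def complex_eq_iff)

  have g_major: "g n s = \<Phi> (w n s) / \<beta> * (w n s / of_real (u n)) powr of_real b
      * exp (- of_real (s\<^sup>2 / 4) * (of_real (u n) / w n s)) * h n s" if "\<bar>\<delta> n * s\<bar> < pi" for n s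
  proof -
    have 1: "indicator {-pi<..<pi} (\<delta> n * s) = (1 :: real)"
      using that by (auto simp: indicator_def abs_less_iff)
    have 2: "of_real (u n powr b) = complex_of_real (u n) powr of_real b"
      using u(1)[of n] by (simp add: powr_of_real)
    have 3: "exp (- of_real (s\<^sup>2 / 4) * (of_real (u n) / w n s))
       = exp (of_real A / w n s) * exp (of_real (A / (u n)\<^sup>2) * w n s) / exp (of_real (2 * A / u n))"
      unfolding exp_add[symmetric] exp_diff[symmetric]
      using saddle_exponent[OF A u(1)[of n] \<delta>(2)[of n] w_def] by simp
    have 4: "w n s powr of_real b \<noteq> 0" "complex_of_real (u n) powr of_real b \<noteq> 0"
      using w_nz[of n s] u(1)[of n] by simp_all
    show ?thesis
      unfolding g_def 1 of_real_mult 2 powr_divide_of_real[OF u(1), symmetric] 3 \<Phi>_def exp_of_real[symmetric]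
      using 4 \<beta> by (simp add: field_simps)
  qed

  have cone_lim: "(\<lambda>n. g n s) \<longlonglongrightarrow> of_real (exp (- s\<^sup>2 / 4)) * h0 s" for s
  proof -
    have wu: "w n s / of_real (u n) = 1 + \<i> * of_real (\<delta> n / u n * s)" for n
      using u(1)[of n] by (simp add: w_def complex_eq_iff)
    have "(\<lambda>n. 1 + \<i> * of_real (\<delta> n / u n * s)) \<longlonglongrightarrow> 1 + \<i> * of_real (0 * s)"
      by (intro tendsto_intros \<delta>u_lim)
    then have wu_lim: "(\<lambda>n. w n s / of_real (u n)) \<longlonglongrightarrow> 1"
      unfolding wu by simp
    have uw_lim: "(\<lambda>n. of_real (u n) / w n s) \<longlonglongrightarrow> 1"
      using tendsto_inverse[OF wu_lim] by simp
    have "(\<lambda>n. \<bar>\<delta> n * s\<bar>) \<longlonglongrightarrow> 0"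
      by (intro tendsto_rabs_zero tendsto_mult_left_zero \<delta>_lim)
    then have ev1: "\<forall>\<^sub>F n in sequentially. \<bar>\<delta> n * s\<bar> < pi"
      by (rule order_tendstoD) simp
    have "(\<lambda>n. \<bar>\<delta> n / u n * s\<bar>) \<longlonglongrightarrow> 0"
      by (intro tendsto_rabs_zero tendsto_mult_left_zero \<delta>u_lim)
    then have "\<forall>\<^sub>F n in sequentially. \<bar>\<delta> n / u n * s\<bar> < M"
      by (rule order_tendstoD) (use M in simp)
    then have cone: "\<forall>\<^sub>F n in sequentially. w n s \<in> major_cone M"
    proof eventually_elim
      case (elim n)
      then have "\<bar>\<delta> n * s\<bar> \<le> M * u n"
        using u(1)[of n] by (simp add: abs_mult field_simps)
      then show ?case
        using u(1)[of n] by (simp add: major_cone_def w_def)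
    qed
    have "(\<lambda>n. of_real (u n) + \<i> * of_real (\<delta> n * s)) \<longlonglongrightarrow> 0 + \<i> * of_real (0 * s)"
      using tendsto_of_real[OF u(2), where 'a = complex] by (intro tendsto_intros \<delta>_lim) simp
    then have "(\<lambda>n. w n s) \<longlonglongrightarrow> 0"
      by (simp add: w_def Complex_eq)
    then have "filterlim (\<lambda>n. w n s) (at 0 within major_cone M) sequentially"
      using cone w_nz by (auto simp: filterlim_at)
    then have \<Phi>_lim: "(\<lambda>n. \<Phi> (w n s)) \<longlonglongrightarrow> \<beta>"
      using filterlim_compose[OF major] by (simp add: \<Phi>_def)
    have "(\<lambda>n. \<Phi> (w n s) / \<beta> * (w n s / of_real (u n)) powr of_real b
        * exp (- of_real (s\<^sup>2 / 4) * (of_real (u n) / w n s)) * h n s)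
       \<longlonglongrightarrow> \<beta> / \<beta> * 1 powr of_real b * exp (- of_real (s\<^sup>2 / 4) * 1) * h0 s"
      using \<beta> by (intro tendsto_intros \<Phi>_lim h_lim uw_lim tendsto_powr_complex wu_lim) auto
    then have "(\<lambda>n. \<Phi> (w n s) / \<beta> * (w n s / of_real (u n)) powr of_real b
        * exp (- of_real (s\<^sup>2 / 4) * (of_real (u n) / w n s)) * h n s)
       \<longlonglongrightarrow> of_real (exp (- s\<^sup>2 / 4)) * h0 s"
      using \<beta> by (simp flip: exp_of_real)
    moreover have "\<forall>\<^sub>F n in sequentially. \<Phi> (w n s) / \<beta> * (w n s / of_real (u n)) powr of_real b
        * exp (- of_real (s\<^sup>2 / 4) * (of_real (u n) / w n s)) * h n s = g n s"
      using ev1 by eventually_elim (rule g_major[symmetric])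
    ultimately show ?thesis
      by (rule Lim_transform_eventually)
  qed

  \<comment> \<open>\<open>(s\<^sup>2/4) Re (u/w) \<ge> a s\<^sup>2\<close> in the cone; the factor \<open>2\<close> in \<open>dom\<close> leaves room for the convergence of \<open>\<Phi>\<close> to \<open>\<beta>\<close>\<close>
  define a where "a = 1 / (4 * (1 + M\<^sup>2))"
  have a: "a > 0"
    unfolding a_def using M by (intro divide_pos_pos mult_pos_pos add_pos_pos) auto
  define dom where "dom s = 2 * (1 + M) powr b * (exp (- a * s\<^sup>2) * \<bar>s\<bar> ^ m) + inverse (1 + s\<^sup>2)" for s
  have dom_int: "integrable lborel dom"
    unfolding dom_def[abs_def]
    by (intro Bochner_Integration.integrable_add integrable_mult_right integrable_gaussian_moment a
          integrable_inverse_1_plus_square')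

  have "\<forall>\<^sub>F w in at 0 within major_cone M. norm (\<Phi> w) < 2 * norm \<beta>"
    using tendsto_norm[OF major] \<beta> unfolding \<Phi>_def by (intro order_tendstoD(2)) auto
  then obtain r where r: "r > 0" "\<And>w. w \<in> major_cone M \<Longrightarrow> w \<noteq> 0 \<Longrightarrow> norm w < r \<Longrightarrow> norm (\<Phi> w) < 2 * norm \<beta>"
    unfolding eventually_at by (auto simp: dist_norm)
  have "(\<lambda>n. (1 + M) * u n) \<longlonglongrightarrow> 0"
    using u(2) by (auto intro!: tendsto_eq_intros)
  then have ev_r: "\<forall>\<^sub>F n in sequentially. (1 + M) * u n < r"
    by (rule order_tendstoD) (use r in simp)
  have ev_minor: "\<forall>\<^sub>F n in sequentially. \<forall>v. M * u n \<le> \<bar>v\<bar> \<and> \<bar>v\<bar> < pi \<longrightarrow>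
                  norm (G (Complex (u n) v)) \<le> L * exp ((A - \<kappa>) / u n)"
    using eventually_compose_filterlim[OF minor u_right] .
  have "\<forall>\<^sub>F u in at_right 0. \<bar>L\<bar> / norm \<beta> * u powr (- b) * exp (- \<kappa> / u) * (1 + pi / sqrt (u ^ 3 / (4 * A))) ^ (m + 2) < 1"
    by (rule order_tendstoD(2)[OF super_exponential_decay[OF A \<kappa>]]) simp
  then have ev_decay: "\<forall>\<^sub>F n in sequentially. \<bar>L\<bar> / norm \<beta> * u n powr (- b) * exp (- \<kappa> / u n) * (1 + pi / \<delta> n) ^ (m + 2) < 1"
    unfolding \<delta>_def by (rule eventually_compose_filterlim[OF _ u_right])

  have "\<forall>\<^sub>F n in sequentially. \<forall>s. norm (g n s) \<le> dom s"
    using ev_r ev_minor ev_decay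
  proof eventually_elim
    case (elim n)
    have un: "u n > 0" by (rule u)
    show ?case
    proof
      fix s
      consider "\<bar>\<delta> n * s\<bar> \<ge> pi" | "\<bar>\<delta> n * s\<bar> < pi" "\<bar>\<delta> n * s\<bar> \<le> M * u n"
        | "\<bar>\<delta> n * s\<bar> < pi" "\<bar>\<delta> n * s\<bar> \<ge> M * u n"
        by linarith
      then show "norm (g n s) \<le> dom s"
      proof cases
        case 1
        then have "g n s = 0"
          by (auto simp: g_def indicator_def abs_less_iff)
        then show ?thesis
          by (simp add: dom_def M less_imp_le add_pos_pos)
      next
        case 2
        have cone: "w n s \<in> major_cone M"
          using 2 un by (simp add: major_cone_def w_def)
        have "norm (w n s) \<le> \<bar>Re (w n s)\<bar> + \<bar>Im (w n s)\<bar>"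
          by (rule cmod_le)
        also have "\<dots> \<le> (1 + M) * u n"
          using 2 un by (simp add: w_def algebra_simps)
        finally have nw: "norm (w n s) \<le> (1 + M) * u n" .
        have \<Phi>: "norm (\<Phi> (w n s)) \<le> 2 * norm \<beta>"
          using r(2)[OF cone w_nz] nw elim by simp
        have "norm ((w n s / of_real (u n)) powr of_real b) = (norm (w n s) / u n) powr b"
          using un by (simp add: norm_powr_real_powr' norm_divide)
        also have "\<dots> \<le> (1 + M) powr b"
          using nw un b by (intro powr_mono2) (auto simp: field_simps)
        finally have powr: "norm ((w n s / of_real (u n)) powr of_real b) \<le> (1 + M) powr b" .
        have "(\<delta> n * s)\<^sup>2 \<le> (M * u n)\<^sup>2"
          using 2 by (intro abs_le_square_iff[THEN iffD1]) auto
        then have "(u n)\<^sup>2 + (\<delta> n * s)\<^sup>2 \<le> (1 + M\<^sup>2) * (u n)\<^sup>2"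
          by (simp add: power_mult_distrib algebra_simps)
        then have "1 / (1 + M\<^sup>2) \<le> (u n)\<^sup>2 / ((u n)\<^sup>2 + (\<delta> n * s)\<^sup>2)"
          using un by (simp add: field_simps add_pos_nonneg)
        also have "\<dots> = Re (of_real (u n) / w n s)"
          by (simp add: Re_divide w_def power2_eq_square)
        finally have "s\<^sup>2 / 4 * (1 / (1 + M\<^sup>2)) \<le> s\<^sup>2 / 4 * Re (of_real (u n) / w n s)"
          by (intro mult_left_mono) auto
        then have le: "a * s\<^sup>2 \<le> s\<^sup>2 / 4 * Re (of_real (u n) / w n s)"
          by (simp add: a_def)
        have Re: "Re (- of_real c * z) = - (c * Re z)" for c z
          by simp
        have exp: "norm (exp (- of_real (s\<^sup>2 / 4) * (of_real (u n) / w n s))) \<le> exp (- a * s\<^sup>2)"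
          unfolding norm_exp_eq_Re Re exp_le_cancel_iff using le by linarith
        have "norm (g n s) = norm (\<Phi> (w n s)) / norm \<beta> * norm ((w n s / of_real (u n)) powr of_real b)
            * norm (exp (- of_real (s\<^sup>2 / 4) * (of_real (u n) / w n s))) * norm (h n s)"
          unfolding g_major[OF 2(1)] norm_mult norm_divide by simp
        also have "\<dots> \<le> 2 * (1 + M) powr b * exp (- a * s\<^sup>2) * \<bar>s\<bar> ^ m"
          using \<Phi> \<beta> by (intro mult_mono powr exp h_bound) (auto simp: divide_simps)
        also have "\<dots> \<le> dom s"
          by (simp add: dom_def add_nonneg_nonneg)
        finally show ?thesis .
      next
        case 3
        have G: "norm (G (w n s)) \<le> \<bar>L\<bar> * exp ((A - \<kappa>) / u n)"
        proof -
          have "norm (G (w n s)) \<le> L * exp ((A - \<kappa>) / u n)"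
            using elim(2) 3 by (simp add: w_def)
          also have "\<dots> \<le> \<bar>L\<bar> * exp ((A - \<kappa>) / u n)"
            by (intro mult_right_mono) auto
          finally show ?thesis .
        qed
        have E: "norm (exp (of_real (A / (u n)\<^sup>2) * w n s)) = exp (A / u n)"
          using un by (simp add: w_def norm_exp_eq_Re power2_eq_square)
        have "\<bar>s\<bar> \<le> pi / \<delta> n"
          using 3 \<delta>(1)[of n] by (simp add: abs_mult field_simps)
        then have s: "1 + \<bar>s\<bar> \<le> 1 + pi / \<delta> n"
          by simp
        have "1 + s\<^sup>2 \<le> (1 + \<bar>s\<bar>)\<^sup>2"
          by (simp add: power2_eq_square algebra_simps)
        then have "\<bar>s\<bar> ^ m * (1 + s\<^sup>2) \<le> (1 + \<bar>s\<bar>) ^ m * (1 + \<bar>s\<bar>)\<^sup>2"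
          by (intro mult_mono power_mono) auto
        also have "\<dots> = (1 + \<bar>s\<bar>) ^ (m + 2)"
          by (simp only: power_add)
        also have "\<dots> \<le> (1 + pi / \<delta> n) ^ (m + 2)"
          using s by (intro power_mono) auto
        finally have poly: "\<bar>s\<bar> ^ m * (1 + s\<^sup>2) \<le> (1 + pi / \<delta> n) ^ (m + 2)" .
        have "norm (g n s) \<le> norm (G (w n s)) * exp (A / u n) * norm (h n s)
             / (norm \<beta> * (u n powr b * exp (2 * A / u n)))"
          unfolding g_def norm_divide norm_mult norm_scaleR E using un
          by (auto simp: indicator_def norm_mult intro!: divide_nonneg_nonneg)
        also have "\<dots> \<le> \<bar>L\<bar> * exp ((A - \<kappa>) / u n) * exp (A / u n) * \<bar>s\<bar> ^ m
             / (norm \<beta> * (u n powr b * exp (2 * A / u n)))"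
          by (intro divide_right_mono mult_mono G h_bound) auto
        also have "\<dots> = \<bar>L\<bar> / norm \<beta> * u n powr (- b) * exp (- \<kappa> / u n) * \<bar>s\<bar> ^ m"
        proof -
          have "exp ((A - \<kappa>) / u n) * exp (A / u n) = exp (2 * A / u n) * exp (- \<kappa> / u n)"
            unfolding exp_add[symmetric] by (simp add: diff_divide_distrib)
          then show ?thesis
            by (simp add: powr_minus field_simps)
        qed
        finally have "norm (g n s) * (1 + s\<^sup>2) \<le> \<bar>L\<bar> / norm \<beta> * u n powr (- b) * exp (- \<kappa> / u n) * \<bar>s\<bar> ^ m * (1 + s\<^sup>2)"
          by (intro mult_right_mono) auto
        also have "\<dots> \<le> \<bar>L\<bar> / norm \<beta> * u n powr (- b) * exp (- \<kappa> / u n) * (1 + pi / \<delta> n) ^ (m + 2)"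
          unfolding mult.assoc by (intro mult_left_mono poly[unfolded mult.assoc]) auto
        also have "\<dots> \<le> 1"
          using elim by simp
        finally have "norm (g n s) \<le> inverse (1 + s\<^sup>2)"
          by (simp add: field_simps add_pos_nonneg)
        also have "\<dots> \<le> dom s"
          by (simp add: dom_def)
        finally show ?thesis .
      qed
    qed
  qed
  then obtain n0 where n0: "\<And>n s. n \<ge> n0 \<Longrightarrow> norm (g n s) \<le> dom s"
    unfolding eventually_sequentially by blast

  have meas: "g n \<in> borel_measurable lborel" for n
  proof -
    have "(\<lambda>s. indicator {- (pi / \<delta> n)<..<pi / \<delta> n} s *\<^sub>R
        (G (w n s) * exp (of_real (A / (u n)\<^sup>2) * w n s) * h n s)) \<in> borel_measurable borel"
    proof (intro borel_measurable_continuous_on_indicator)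
      have cw: "continuous_on UNIV (w n)"
        unfolding w_def[abs_def] Complex_eq by (intro continuous_intros)
      then have "continuous_on UNIV (\<lambda>s. G (w n s))"
        using u(1)[of n] by (intro continuous_on_compose2[OF cont]) (auto simp: w_def)
      then have "continuous_on UNIV (\<lambda>s. G (w n s) * exp (of_real (A / (u n)\<^sup>2) * w n s) * h n s)"
        by (intro continuous_intros cw h_meas)
      then show "continuous_on {- (pi / \<delta> n)<..<pi / \<delta> n} (\<lambda>s. G (w n s) * exp (of_real (A / (u n)\<^sup>2) * w n s) * h n s)"
        by (rule continuous_on_subset) auto
    qed auto
    moreover have "indicator {- (pi / \<delta> n)<..<pi / \<delta> n} s = (indicator {-pi<..<pi} (\<delta> n * s) :: real)" for s
      using \<delta>(1)[of n] by (auto simp: indicator_def field_simps)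
    ultimately show ?thesis
      unfolding g_def[abs_def] by (simp add: measurable_lborel1)
  qed

  have "(\<lambda>n. \<integral>s. g (n + n0) s \<partial>lborel) \<longlonglongrightarrow> (\<integral>s. of_real (exp (- s\<^sup>2 / 4)) * h0 s \<partial>lborel)"
  proof (rule integral_dominated_convergence[where w = dom])
    have "(\<lambda>n. g n s) \<longlonglongrightarrow> of_real (exp (- s\<^sup>2 / 4)) * h0 s" for s by (rule cone_lim)
    then have lim: "(\<lambda>n. g (n + n0) s) \<longlonglongrightarrow> of_real (exp (- s\<^sup>2 / 4)) * h0 s" for s
      by (rule LIMSEQ_ignore_initial_segment)
    then show "AE s in lborel. (\<lambda>n. g (n + n0) s) \<longlonglongrightarrow> of_real (exp (- s\<^sup>2 / 4)) * h0 s"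
      by simp
    show "(\<lambda>s. of_real (exp (- s\<^sup>2 / 4)) * h0 s) \<in> borel_measurable lborel"
      by (rule borel_measurable_LIMSEQ_metric[OF meas lim])
  qed (use meas dom_int n0 in auto)
  then have "(\<lambda>n. \<integral>s. g n s \<partial>lborel) \<longlonglongrightarrow> (\<integral>s. of_real (exp (- s\<^sup>2 / 4)) * h0 s \<partial>lborel)"
    by (rule LIMSEQ_offset)
  then show ?thesis
    by (simp add: g_def w_def)
qed

section \<open>Fourier coefficients of a Dirichlet series near its saddle point\<close>

lemma poly_jensen_poly: "poly (jensen_poly \<alpha> d n) x = (\<Sum>j\<le>d. real (d choose j) * \<alpha> (n + j) * x ^ j)"
  by (simp add: jensen_poly_def poly_sum poly_monom)

lemma degree_jensen_poly: "degree (jensen_poly \<alpha> d n) \<le> d"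
  unfolding jensen_poly_def by (intro degree_sum_le) (auto intro: order.trans[OF degree_monom_le])

lemma uniform_limit_of_coeffs:
  fixes c :: "nat \<Rightarrow> nat \<Rightarrow> real"
  assumes "bounded S" and lim: "\<And>k. (\<lambda>n. c n k) \<longlonglongrightarrow> l k"
  shows "uniform_limit S (\<lambda>n X. \<Sum>k\<le>d. c n k * X ^ k) (\<lambda>X. \<Sum>k\<le>d. l k * X ^ k) sequentially"
proof -
  obtain B where B: "\<And>X. X \<in> S \<Longrightarrow> \<bar>X\<bar> \<le> B"
    using assms(1) by (auto simp: bounded_iff)
  have monomial: "uniform_limit S (\<lambda>n X. c n k * X ^ k) (\<lambda>X. l k * X ^ k) sequentially" for k
  proof (rule uniform_lim_mult)
    show "uniform_limit S (\<lambda>n X. c n k) (\<lambda>X. l k) sequentially"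
      using lim[of k] by (auto simp: uniform_limit_iff tendsto_iff elim: eventually_mono)
    have "\<bar>X ^ k\<bar> \<le> B ^ k" if "X \<in> S" for X
      using B[OF that] by (simp add: power_abs power_mono)
    then show "bounded ((\<lambda>X. X ^ k) ` S)"
      by (auto simp: bounded_iff)
  qed (auto intro: uniform_limit_const simp: bounded_iff)
  show ?thesis
  proof (induction d)
    case 0
    show ?case
      using monomial[of 0] by simp
  next
    case (Suc d)
    then show ?case
      unfolding sum.atMost_Suc by (intro uniform_limit_add monomial)
  qed
qed

lemma norm_one_minus_iexp: "norm (1 - exp (\<i> * of_real v)) \<le> \<bar>v\<bar>"
  using iexp_approx1[of v 0] by (simp add: norm_minus_commute)

lemma set_integrable_Ioo_continuous:
  fixes f :: "real \<Rightarrow> complex"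
  assumes "continuous_on UNIV f"
  shows "integrable lborel (\<lambda>v. indicator {a<..<b} v *\<^sub>R f v)"
proof -
  have "set_integrable lborel {a..b} f"
    using assms by (intro borel_integrable_atLeastAtMost') (auto intro: continuous_on_subset)
  then have "set_integrable lborel {a<..<b} f"
    by (rule set_integrable_subset) auto
  then show ?thesis
    by (simp add: set_integrable_def)
qed

lemma integral_iexp_period:
  "(\<integral>v. indicator {-pi<..<pi} v *\<^sub>R exp (\<i> * of_int k * of_real v) \<partial>lborel) = (if k = 0 then 2 * of_real pi else 0)"
proof -
  have cont: "continuous_on UNIV (\<lambda>v. exp (\<i> * of_int k * complex_of_real v))"
    by (intro continuous_intros)
  have "(\<integral>v. indicator {-pi<..<pi} v *\<^sub>R exp (\<i> * of_int k * of_real v) \<partial>lborel)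
      = integral {-pi<..<pi} (\<lambda>v. exp (\<i> * of_int k * complex_of_real v))"
    using set_borel_integral_eq_integral(2)[of "{-pi<..<pi}" "\<lambda>v. exp (\<i> * of_int k * complex_of_real v)"]
      set_integrable_Ioo_continuous[OF cont, of "-pi" pi]
    by (simp add: set_integrable_def set_lebesgue_integral_def)
  also have "\<dots> = integral {-pi..pi} (\<lambda>v. exp (\<i> * of_int k * complex_of_real v))"
    by (rule integral_open_interval_real[symmetric])
  also have "\<dots> = (if k = 0 then 2 * of_real pi else 0)"
  proof (cases "k = 0")
    case False
    have "((\<lambda>v. exp (\<i> * of_int k * complex_of_real v)) has_integral
        exp (\<i> * of_int k * complex_of_real pi) / (\<i> * of_int k)
        - exp (\<i> * of_int k * complex_of_real (- pi)) / (\<i> * of_int k)) {-pi..pi}"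
    proof (intro fundamental_theorem_of_calculus has_vector_derivative_real_field
        [where f = "\<lambda>z. exp (\<i> * of_int k * z) / (\<i> * of_int k)"])
      show "((\<lambda>z. exp (\<i> * of_int k * z) / (\<i> * of_int k)) has_field_derivative
          exp (\<i> * of_int k * of_real v)) (at (of_real v))" for v
        using False by (auto intro!: derivative_eq_intros)
    qed simp
    moreover have "exp (\<i> * of_int k * complex_of_real pi) = exp (\<i> * of_int k * complex_of_real (- pi))"
      unfolding exp_eq by (intro exI[of _ k]) (simp add: algebra_simps)
    ultimately show ?thesis
      using False by (simp add: integral_unique)
  qed (simp add: scaleR_conv_of_real)
  finally show ?thesis .
qed

text \<open>
  The situation of the theorem after the reduction to period \<open>2 \<pi>\<close>: \<open>G(w)\<close> is the generating series of
  \<open>C\<close> at \<open>exp (- w)\<close>, and the expansion in the cone is reduced to its leading term. The minor arc is only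
  given in the upper half-plane below height \<open>\<pi>\<close>: as \<open>C\<close> is real, conjugation supplies the other half.
\<close>
locale dirichlet_saddle =
  fixes C :: "nat \<Rightarrow> real" and G :: "complex \<Rightarrow> complex" and A M \<kappa> b L :: real and \<beta> :: complex
  assumes A: "A > 0" and M: "M > 0" and \<kappa>: "\<kappa> > 0" and b: "b \<ge> 0" and \<beta>: "\<beta> \<noteq> 0"
    and G_sums: "\<And>w. Re w > 0 \<Longrightarrow> (\<lambda>n. of_real (C n) * exp (- of_nat n * w)) sums G w"
    and major: "((\<lambda>w. G w / (w powr of_real b * exp (of_real A / w))) \<longlongrightarrow> \<beta>) (at 0 within major_cone M)"
    and minor: "\<forall>\<^sub>F u in at_right 0. \<forall>v. M * u \<le> v \<and> v < pi \<longrightarrow>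
                  norm (G (Complex u v)) \<le> L * exp ((A - \<kappa>) / u)"
begin

text \<open>
  The saddle point \<open>u\<close> with \<open>n = A/u\<^sup>2\<close> (the value at \<open>n = 0\<close> is arbitrary but positive), and the width of the
  peak on the vertical line through it. They serve as the two normalising sequences of the Jensen
  polynomials.
\<close>
definition saddle :: "nat \<Rightarrow> real" where
  "saddle n = (if n = 0 then 1 else sqrt (A / n))"

definition width :: "nat \<Rightarrow> real" where
  "width n = sqrt (saddle n ^ 3 / (4 * A))"

lemma saddle_pos: "saddle n > 0"
  using A by (simp add: saddle_def)

lemma width_pos: "width n > 0"
  using A saddle_pos by (simp add: width_def)

lemma saddle_lim: "saddle \<longlonglongrightarrow> 0"
proof -
  have "(\<lambda>n. sqrt (A / real n)) \<longlonglongrightarrow> 0"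
    using tendsto_real_sqrt[OF lim_const_over_n[of A]] by simp
  moreover have "\<forall>\<^sub>F n in sequentially. sqrt (A / real n) = saddle n"
    using eventually_gt_at_top[of 0] by eventually_elim (simp add: saddle_def)
  ultimately show ?thesis
    by (rule Lim_transform_eventually)
qed

lemma width_lim: "width \<longlonglongrightarrow> 0"
  unfolding width_def[abs_def] using A by (auto intro!: tendsto_eq_intros saddle_lim)

lemma summable_norm_G:
  assumes "Re w > 0"
  shows "summable (\<lambda>n. \<bar>C n\<bar> * exp (- n * Re w))"
proof -
  define q where "q = exp (- of_real (Re w / 2) :: complex)"
  have "summable (\<lambda>n. of_real (C n) * q ^ n)"
    using sums_summable[OF G_sums[of "of_real (Re w / 2)"]] assms
    by (simp add: q_def exp_of_nat_mult[symmetric])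
  then have "summable (\<lambda>n. norm (of_real (C n) * complex_of_real (exp (- Re w)) ^ n))"
    by (rule powser_insidea) (use assms in \<open>simp add: q_def norm_exp_eq_Re\<close>)
  then show ?thesis
    by (simp add: norm_mult norm_power exp_of_nat_mult[symmetric] mult.commute)
qed

lemma G_cnj:
  assumes "Re w > 0"
  shows "G (cnj w) = cnj (G w)"
proof -
  have "(\<lambda>n. cnj (of_real (C n) * exp (- of_nat n * w))) sums cnj (G w)"
    using G_sums[OF assms] by (rule sums_cnj[THEN iffD2])
  then have "(\<lambda>n. of_real (C n) * exp (- of_nat n * cnj w)) sums cnj (G w)"
    by (simp add: exp_cnj)
  with G_sums[of "cnj w"] assms show ?thesis
    by (simp add: sums_unique2)
qed

lemma G_continuous: "continuous_on {w. Re w > 0} G"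
proof -
  define f where "f q = (\<Sum>n. of_real (C n) * q ^ n)" for q :: complex
  have sums: "(\<lambda>n. of_real (C n) * (q - 0) ^ n) sums f q" if "q \<in> ball 0 1" for q :: complex
  proof -
    have "norm q < 1"
      using that by simp
    then obtain r where r: "norm q < r" "r < 1"
      using dense by blast
    then have "r > 0"
      using norm_ge_zero le_less_trans by blast
    have "summable (\<lambda>n. norm (of_real (C n) * (complex_of_real r) ^ n))"
      using summable_norm_G[of "- of_real (ln r)"] r \<open>r > 0\<close>
      by (simp add: norm_mult norm_power exp_of_nat_mult)
    then have "summable (\<lambda>n. of_real (C n) * (complex_of_real r) ^ n)"
      by (rule summable_norm_cancel)
    then have "summable (\<lambda>n. norm (of_real (C n) * q ^ n))"
      by (rule powser_insidea) (use r \<open>r > 0\<close> in simp)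
    then show ?thesis
      unfolding f_def by (simp add: summable_norm_cancel summable_sums)
  qed
  have "f holomorphic_on ball 0 1"
    by (rule power_series_holomorphic) (rule sums)
  then have "continuous_on (ball 0 1) f"
    by (rule holomorphic_on_imp_continuous_on)
  then have "continuous_on {w. Re w > 0} (\<lambda>w. f (exp (- w)))"
    by (rule continuous_on_compose2) (auto intro!: continuous_intros simp: norm_exp_eq_Re)
  moreover have "f (exp (- w)) = G w" if "Re w > 0" for w
    using G_sums[OF that] by (simp add: f_def exp_of_nat_mult[symmetric] sums_iff)
  ultimately show ?thesis
    by (rule continuous_on_eq) simp
qed

lemma minor_symmetric:
  "\<forall>\<^sub>F u in at_right 0. \<forall>v. M * u \<le> \<bar>v\<bar> \<and> \<bar>v\<bar> < pi \<longrightarrow>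
                  norm (G (Complex u v)) \<le> L * exp ((A - \<kappa>) / u)"
  using minor eventually_at_right_less[of 0]
proof eventually_elim
  case (elim u)
  have "norm (G (Complex u v)) \<le> L * exp ((A - \<kappa>) / u)" if "M * u \<le> \<bar>v\<bar>" "\<bar>v\<bar> < pi" for v
  proof (cases "v \<ge> 0")
    case False
    have "norm (G (Complex u v)) = norm (G (cnj (Complex u (- v))))"
      by (simp add: complex_cnj)
    also have "\<dots> = norm (G (Complex u (- v)))"
      using elim by (subst G_cnj) auto
    also have "\<dots> \<le> L * exp ((A - \<kappa>) / u)"
      using elim that False by auto
    finally show ?thesis .
  qed (use elim that in auto)
  then show ?case
    by blast
qed

lemma continuous_G_line:
  assumes "u > 0"
  shows "continuous_on UNIV (\<lambda>v. G (Complex u v))"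
  using assms unfolding Complex_eq by (intro continuous_on_compose2[OF G_continuous]) (auto intro!: continuous_intros)

text \<open>
  Termwise integration, justified by absolute convergence on the line \<open>Re w = u\<close>.
\<close>
lemma fourier_coefficient:
  assumes "u > 0"
  shows "(\<integral>v. indicator {-pi<..<pi} v *\<^sub>R (G (Complex u v) * exp (of_nat m * Complex u v)) \<partial>lborel)
       = 2 * of_real pi * of_real (C m)"
proof -
  define f where "f n v = indicator {-pi<..<pi} v *\<^sub>R
     (of_real (C n) * exp (- of_nat n * Complex u v) * exp (of_nat m * Complex u v))" for n v
  have f_sums: "(\<lambda>n. f n v) sums (indicator {-pi<..<pi} v *\<^sub>R (G (Complex u v) * exp (of_nat m * Complex u v)))" for v
    unfolding f_def by (intro sums_scaleR_right sums_mult2 G_sums) (use assms in simp)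
  have f_int: "integrable lborel (f n)" for n
    unfolding f_def[abs_def] Complex_eq
    by (intro set_integrable_Ioo_continuous continuous_intros)
  have f_norm: "norm (f n v) = indicator {-pi<..<pi} v * (\<bar>C n\<bar> * exp (- n * u) * exp (m * u))" for n v
    by (simp add: f_def norm_mult norm_exp_eq_Re)
  have f_coeff: "integral\<^sup>L lborel (f n) = (if n = m then 2 * of_real pi * of_real (C m) else 0)" for n
  proof -
    have "f n v = (of_real (C n) * exp (of_int (int m - int n) * of_real u)) *
        (indicator {-pi<..<pi} v *\<^sub>R exp (\<i> * of_int (int m - int n) * of_real v))" for v
    proof -
      have "exp (- of_nat n * Complex u v) * exp (of_nat m * Complex u v)
         = exp (of_int (int m - int n) * of_real u) * exp (\<i> * of_int (int m - int n) * of_real v)"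
        unfolding exp_add[symmetric] by (simp add: Complex_eq algebra_simps)
      then show ?thesis
        by (simp add: f_def mult.assoc scaleR_conv_of_real)
    qed
    then have f_eq: "f n = (\<lambda>v. (of_real (C n) * exp (of_int (int m - int n) * of_real u)) *
        (indicator {-pi<..<pi} v *\<^sub>R exp (\<i> * of_int (int m - int n) * of_real v)))"
      by (rule ext)
    show ?thesis
      unfolding f_eq integral_mult_right_zero integral_iexp_period by simp
  qed
  have sumC: "summable (\<lambda>n. \<bar>C n\<bar> * exp (- n * u) * exp (m * u))"
    using summable_norm_G[of "of_real u"] assms by (intro summable_mult2) simp
  have "(\<lambda>n. integral\<^sup>L lborel (f n)) sums (\<integral>v. (\<Sum>n. f n v) \<partial>lborel)"
  proof (rule sums_integral[OF f_int])
    show "AE v in lborel. summable (\<lambda>n. norm (f n v))"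
      unfolding f_norm using summable_mult[OF sumC] by (intro AE_I2) simp
    have "(\<integral>v. norm (f n v) \<partial>lborel) = 2 * pi * (\<bar>C n\<bar> * exp (- n * u) * exp (m * u))" for n
      unfolding f_norm by simp
    then show "summable (\<lambda>n. \<integral>v. norm (f n v) \<partial>lborel)"
      using summable_mult[OF sumC, of "2 * pi"] by simp
  qed
  moreover have "(\<lambda>n. integral\<^sup>L lborel (f n)) sums (2 * of_real pi * of_real (C m))"
    unfolding f_coeff using sums_If_finite_set[of "{m}" "\<lambda>_. 2 * of_real pi * complex_of_real (C m)"] by simp
  ultimately have "(\<integral>v. (\<Sum>n. f n v) \<partial>lborel) = 2 * of_real pi * of_real (C m)"
    by (rule sums_unique2)
  then show ?thesis
    using f_sums by (simp add: sums_iff)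
qed

text \<open>
  Expanding \<open>((1 - e\<^sup>i\<^sup>v) + \<delta> X e\<^sup>i\<^sup>v)\<^sup>d\<close> by powers of \<open>X\<close>, at \<open>v = \<delta> s\<close> and with all powers of \<open>\<delta>\<close> taken out,
  produces these factors with \<open>p = d - k\<close>; they are bounded by \<open>\<bar>s\<bar>\<^sup>p\<close> and tend to \<open>(- \<i> s)\<^sup>p\<close>.
\<close>
definition peak_factor :: "nat \<Rightarrow> nat \<Rightarrow> nat \<Rightarrow> real \<Rightarrow> complex" where
  "peak_factor k p n s = exp (\<i> * of_real (width n * s)) ^ k *
     ((1 - exp (\<i> * of_real (width n * s))) / of_real (width n)) ^ p"

definition peak_integral :: "nat \<Rightarrow> nat \<Rightarrow> nat \<Rightarrow> complex" where
  "peak_integral k p n = (\<integral>s. indicator {-pi<..<pi} (width n * s) *\<^sub>R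
     (G (Complex (saddle n) (width n * s)) * exp (of_real (A / (saddle n)\<^sup>2) * Complex (saddle n) (width n * s))
       * peak_factor k p n s) \<partial>lborel)"

text \<open>
  The asymptotic value of \<open>G(w) exp (n w)\<close> at the saddle point \<open>w = u\<close>; it cancels in every quotient of peak integrals.
\<close>
definition peak_size :: "nat \<Rightarrow> complex" where
  "peak_size n = \<beta> * of_real (saddle n powr b * exp (2 * A / saddle n))"

lemma peak_integral_lim:
  "(\<lambda>n. peak_integral k p n / peak_size n) \<longlonglongrightarrow> of_real (2 * sqrt pi * hermite p 0)"
proof -
  have ne: "width n \<noteq> 0" for n
    using width_pos[of n] by simp
  have cont: "continuous_on UNIV (peak_factor k p n)" for n
    unfolding peak_factor_def[abs_def] using ne by (intro continuous_intros) auto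
  have bound: "norm (peak_factor k p n s) \<le> \<bar>s\<bar> ^ p" for n s
  proof -
    have "norm (1 - exp (\<i> * of_real (width n * s))) / width n \<le> \<bar>s\<bar>"
      using norm_one_minus_iexp[of "width n * s"] width_pos[of n] by (simp add: abs_mult field_simps)
    then show ?thesis
      using width_pos[of n]
      by (auto simp: peak_factor_def norm_mult norm_power norm_divide simp del: of_real_mult intro!: power_mono)
  qed
  have lim: "(\<lambda>n. peak_factor k p n s) \<longlonglongrightarrow> (- (\<i> * of_real s)) ^ p" for s
  proof -
    have "((\<lambda>t. exp (\<i> * of_real s * t)) has_field_derivative (\<i> * of_real s)) (at (0 :: complex))"
      by (auto intro!: derivative_eq_intros)
    then have "((\<lambda>t. (exp (\<i> * of_real s * t) - 1) / t) \<longlongrightarrow> \<i> * of_real s) (at (0 :: complex))"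
      by (simp add: has_field_derivative_iff)
    moreover have width': "filterlim (\<lambda>n. complex_of_real (width n)) (at 0) sequentially"
      using ne tendsto_of_real[OF width_lim, where 'a = complex] by (auto simp: filterlim_at)
    ultimately have "(\<lambda>n. (exp (\<i> * of_real s * of_real (width n)) - 1) / of_real (width n)) \<longlonglongrightarrow> \<i> * of_real s"
      by (rule filterlim_compose)
    then have *: "(\<lambda>n. - ((exp (\<i> * of_real s * of_real (width n)) - 1) / of_real (width n))) \<longlonglongrightarrow> - (\<i> * of_real s)"
      by (rule tendsto_minus)
    have "(\<lambda>n. exp (\<i> * of_real (width n * s)) ^ k * (- ((exp (\<i> * of_real s * of_real (width n)) - 1) / of_real (width n))) ^ p)
      \<longlonglongrightarrow> exp (\<i> * of_real (0 * s)) ^ k * (- (\<i> * of_real s)) ^ p"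
      by (intro tendsto_intros width_lim *)
    then show ?thesis
      by (simp add: peak_factor_def mult_ac minus_divide_left del: divide_minus_left)
  qed
  have "(\<lambda>n. \<integral>s. indicator {-pi<..<pi} (width n * s) *\<^sub>R
     (G (Complex (saddle n) (width n * s)) * exp (of_real (A / (saddle n)\<^sup>2) * Complex (saddle n) (width n * s))
       * peak_factor k p n s) / peak_size n \<partial>lborel)
     \<longlonglongrightarrow> (\<integral>s. of_real (exp (- s\<^sup>2 / 4)) * (- (\<i> * of_real s)) ^ p \<partial>lborel)"
    unfolding peak_size_def
    by (rule saddle_point_limit[OF A M \<kappa> b \<beta> G_continuous major minor_symmetric saddle_pos saddle_lim
          width_def cont bound lim])
  then show ?thesis
    unfolding gaussian_moment_hermite peak_integral_def by simp
qed

text \<open>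
  All the numbers \<open>C(n + j)\<close> are Fourier coefficients on the same line \<open>w = u + \<i> v\<close>:
  \<open>2 \<pi> C(n + j) e\<^sup>-\<^sup>u\<^sup>j\<close> is the integral of \<open>g(v) e\<^sup>i\<^sup>j\<^sup>v\<close> with \<open>g(v) = G(w) exp (n w)\<close>. So the binomial sum over
  \<open>j\<close> that defines the Jensen polynomial at \<open>(\<delta> X - 1)/e\<^sup>u\<close> collapses to
  \<open>(1 + e\<^sup>i\<^sup>v (\<delta> X - 1))\<^sup>d = ((1 - e\<^sup>i\<^sup>v) + \<delta> X e\<^sup>i\<^sup>v)\<^sup>d\<close> under the integral. Near the peak both summands are of
  order \<open>\<delta>\<close>, which is what the shift by \<open>- 1\<close> and the factor \<open>e\<^sup>-\<^sup>u\<close> are for.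
\<close>
lemma jensen_poly_peak_integrals:
  assumes "n > 0"
  shows "2 * of_real pi * of_real (poly (jensen_poly C d n) ((width n * X - 1) / exp (saddle n)))
    = of_real (width n ^ (d + 1)) * (\<Sum>k\<le>d. of_nat (d choose k) * of_real X ^ k * peak_integral k (d - k) n)"
proof -
  define u where "u = saddle n"
  define \<delta> where "\<delta> = width n"
  define E where "E v = exp (\<i> * complex_of_real v)" for v
  define g where "g v = G (Complex u v) * exp (of_nat n * Complex u v)" for v
  have u: "u > 0" and \<delta>: "\<delta> > 0"
    by (simp_all add: u_def \<delta>_def saddle_pos width_pos)
  have An: "A / (saddle n)\<^sup>2 = real n"
    using A assms by (simp add: saddle_def)
  have cont: "continuous_on UNIV g" "continuous_on UNIV E"
    unfolding g_def[abs_def] E_def[abs_def] using continuous_G_line[OF u] unfolding Complex_eq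
    by (intro continuous_intros; simp)+
  have int: "integrable lborel (\<lambda>v. indicator {-pi<..<pi} v *\<^sub>R (g v * f v))" if "continuous_on UNIV f" for f
    by (intro set_integrable_Ioo_continuous continuous_intros cont that)
  have coeff: "(\<integral>v. indicator {-pi<..<pi} v *\<^sub>R (g v * E v ^ j) \<partial>lborel)
      = 2 * of_real pi * of_real (C (n + j)) * of_real (exp (- u)) ^ j" for j
  proof -
    have *: "g v * E v ^ j = (G (Complex u v) * exp (of_nat (n + j) * Complex u v)) * of_real (exp (- u)) ^ j" for v
    proof -
      have "E v = exp (Complex u v) * of_real (exp (- u))"
        by (simp add: E_def Complex_eq exp_of_real[symmetric] exp_add[symmetric])
      then have "E v ^ j = exp (of_nat j * Complex u v) * of_real (exp (- u)) ^ j"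
        by (simp add: power_mult_distrib exp_of_nat_mult)
      then show ?thesis
        by (simp add: g_def exp_add distrib_right)
    qed
    have "(\<integral>v. indicator {-pi<..<pi} v *\<^sub>R (g v * E v ^ j) \<partial>lborel)
      = (\<integral>v. (indicator {-pi<..<pi} v *\<^sub>R (G (Complex u v) * exp (of_nat (n + j) * Complex u v)))
           * of_real (exp (- u)) ^ j \<partial>lborel)"
      unfolding * by simp
    also have "\<dots> = 2 * of_real pi * of_real (C (n + j)) * of_real (exp (- u)) ^ j"
      unfolding integral_mult_left_zero fourier_coefficient[OF u] ..
    finally show ?thesis .
  qed
  define Y where "Y = complex_of_real (\<delta> * X - 1)"
  have "2 * of_real pi * of_real (poly (jensen_poly C d n) ((\<delta> * X - 1) / exp u))
      = (\<Sum>j\<le>d. of_nat (d choose j) * Y ^ j * (2 * of_real pi * of_real (C (n + j)) * of_real (exp (- u)) ^ j))"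
    unfolding poly_jensen_poly Y_def
    by (simp add: sum_distrib_left power_divide exp_minus divide_inverse power_inverse power_mult_distrib mult_ac)
  also have "\<dots> = (\<Sum>j\<le>d. \<integral>v. of_nat (d choose j) * Y ^ j * (indicator {-pi<..<pi} v *\<^sub>R (g v * E v ^ j)) \<partial>lborel)"
    unfolding integral_mult_right_zero coeff ..
  also have "\<dots> = (\<integral>v. (\<Sum>j\<le>d. of_nat (d choose j) * Y ^ j * (indicator {-pi<..<pi} v *\<^sub>R (g v * E v ^ j))) \<partial>lborel)"
    by (intro Bochner_Integration.integral_sum[symmetric] integrable_mult_right int continuous_intros cont)
  also have "\<dots> = (\<integral>v. (\<Sum>k\<le>d. of_nat (d choose k) * of_real (\<delta> * X) ^ k *
       (indicator {-pi<..<pi} v *\<^sub>R (g v * (E v ^ k * (1 - E v) ^ (d - k))))) \<partial>lborel)"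
  proof (intro Bochner_Integration.integral_cong refl)
    fix v
    have "(\<Sum>j\<le>d. of_nat (d choose j) * Y ^ j * (indicator {-pi<..<pi} v *\<^sub>R (g v * E v ^ j)))
        = indicator {-pi<..<pi} v *\<^sub>R (g v * (\<Sum>j\<le>d. of_nat (d choose j) * (Y * E v) ^ j * 1 ^ (d - j)))"
      by (simp add: sum_distrib_left scaleR_sum_right power_mult_distrib mult_ac)
    also have "(\<Sum>j\<le>d. of_nat (d choose j) * (Y * E v) ^ j * 1 ^ (d - j)) = (Y * E v + 1) ^ d"
      by (rule binomial_ring[symmetric])
    also have "Y * E v + 1 = of_real (\<delta> * X) * E v + (1 - E v)"
      by (simp add: Y_def algebra_simps)
    also have "\<dots> ^ d = (\<Sum>k\<le>d. of_nat (d choose k) * (of_real (\<delta> * X) * E v) ^ k * (1 - E v) ^ (d - k))"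
      by (rule binomial_ring)
    also have "indicator {-pi<..<pi} v *\<^sub>R (g v * \<dots>) = (\<Sum>k\<le>d. of_nat (d choose k) * of_real (\<delta> * X) ^ k *
       (indicator {-pi<..<pi} v *\<^sub>R (g v * (E v ^ k * (1 - E v) ^ (d - k)))))"
      by (simp add: sum_distrib_left scaleR_sum_right power_mult_distrib mult_ac)
    finally show "(\<Sum>j\<le>d. of_nat (d choose j) * Y ^ j * (indicator {-pi<..<pi} v *\<^sub>R (g v * E v ^ j)))
       = (\<Sum>k\<le>d. of_nat (d choose k) * of_real (\<delta> * X) ^ k *
       (indicator {-pi<..<pi} v *\<^sub>R (g v * (E v ^ k * (1 - E v) ^ (d - k)))))" .
  qed
  also have "\<dots> = (\<Sum>k\<le>d. \<integral>v. of_nat (d choose k) * of_real (\<delta> * X) ^ k *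
       (indicator {-pi<..<pi} v *\<^sub>R (g v * (E v ^ k * (1 - E v) ^ (d - k)))) \<partial>lborel)"
    by (intro Bochner_Integration.integral_sum integrable_mult_right int continuous_intros cont)
  also have "\<dots> = (\<Sum>k\<le>d. of_nat (d choose k) * of_real (\<delta> * X) ^ k * (of_real (\<delta> ^ (d - k + 1)) * peak_integral k (d - k) n))"
  proof (intro sum.cong refl)
    fix k
    have "(\<integral>v. indicator {-pi<..<pi} v *\<^sub>R (g v * (E v ^ k * (1 - E v) ^ (d - k))) \<partial>lborel)
       = \<delta> *\<^sub>R (\<integral>s. indicator {-pi<..<pi} (\<delta> * s) *\<^sub>R (g (\<delta> * s) * (E (\<delta> * s) ^ k * (1 - E (\<delta> * s)) ^ (d - k))) \<partial>lborel)"
      using \<delta> by (subst lborel_integral_real_affine[where c = \<delta> and t = 0]) auto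
    also have "(\<lambda>s. indicator {-pi<..<pi} (\<delta> * s) *\<^sub>R (g (\<delta> * s) * (E (\<delta> * s) ^ k * (1 - E (\<delta> * s)) ^ (d - k))))
       = (\<lambda>s. of_real (\<delta> ^ (d - k)) * (indicator {-pi<..<pi} (width n * s) *\<^sub>R
     (G (Complex (saddle n) (width n * s)) * exp (of_real (A / (saddle n)\<^sup>2) * Complex (saddle n) (width n * s))
       * peak_factor k (d - k) n s)))"
      unfolding An using \<delta> by (simp add: fun_eq_iff g_def E_def peak_factor_def power_divide flip: u_def \<delta>_def)
    also have "(\<integral>s. \<dots> s \<partial>lborel) = of_real (\<delta> ^ (d - k)) * peak_integral k (d - k) n"
      unfolding integral_mult_right_zero peak_integral_def ..
    finally have "(\<integral>v. indicator {-pi<..<pi} v *\<^sub>R (g v * (E v ^ k * (1 - E v) ^ (d - k))) \<partial>lborel)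
       = of_real (\<delta> ^ (d - k + 1)) * peak_integral k (d - k) n"
      by (simp add: scaleR_conv_of_real)
    then show "(\<integral>v. of_nat (d choose k) * of_real (\<delta> * X) ^ k *
       (indicator {-pi<..<pi} v *\<^sub>R (g v * (E v ^ k * (1 - E v) ^ (d - k)))) \<partial>lborel)
       = of_nat (d choose k) * of_real (\<delta> * X) ^ k * (of_real (\<delta> ^ (d - k + 1)) * peak_integral k (d - k) n)"
      unfolding integral_mult_right_zero by simp
  qed
  also have "\<dots> = of_real (\<delta> ^ (d + 1)) * (\<Sum>k\<le>d. of_nat (d choose k) * of_real X ^ k * peak_integral k (d - k) n)"
    unfolding sum_distrib_left
  proof (intro sum.cong refl)
    fix k assume "k \<in> {..d}"
    then have "\<delta> ^ (d + 1) = \<delta> ^ k * \<delta> ^ (d - k + 1)"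
      by (simp flip: power_add)
    then show "of_nat (d choose k) * of_real (\<delta> * X) ^ k * (of_real (\<delta> ^ (d - k + 1)) * peak_integral k (d - k) n)
       = of_real (\<delta> ^ (d + 1)) * (of_nat (d choose k) * of_real X ^ k * peak_integral k (d - k) n)"
      by (simp add: power_mult_distrib mult_ac del: power_Suc)
  qed
  finally show ?thesis
    by (simp only: u_def \<delta>_def)
qed

text \<open>
  The case \<open>d = 0\<close> of the integral representation expresses \<open>C n\<close> itself. Real parts may be taken because the
  left-hand side is real for all real \<open>X\<close>.
\<close>
lemma normalised_jensen_poly:
  assumes "n > 0"
  shows "width n powi (- int d) / C n * poly (jensen_poly C d n) ((width n * X - 1) / exp (saddle n))
    = (\<Sum>k\<le>d. real (d choose k) * Re (peak_integral k (d - k) n / peak_integral 0 0 n) * X ^ k)"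
proof -
  have C: "2 * of_real pi * of_real (C n) = of_real (width n) * peak_integral 0 0 n"
    using jensen_poly_peak_integrals[OF assms, of 0 0] by (simp add: poly_jensen_poly)
  have "complex_of_real (width n powi (- int d) / C n * poly (jensen_poly C d n) ((width n * X - 1) / exp (saddle n)))
    = of_real (inverse (width n ^ d)) / (2 * of_real pi * of_real (C n))
       * (2 * of_real pi * of_real (poly (jensen_poly C d n) ((width n * X - 1) / exp (saddle n))))"
    by (simp add: power_int_minus)
  also have "\<dots> = (\<Sum>k\<le>d. of_nat (d choose k) * of_real X ^ k * peak_integral k (d - k) n) / peak_integral 0 0 n"
    unfolding C jensen_poly_peak_integrals[OF assms] using width_pos[of n] by (simp add: field_simps)
  also have "\<dots> = (\<Sum>k\<le>d. of_real (real (d choose k) * X ^ k) * (peak_integral k (d - k) n / peak_integral 0 0 n))"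
    by (simp add: sum_divide_distrib)
  finally have eq: "Re (complex_of_real (width n powi (- int d) / C n * poly (jensen_poly C d n) ((width n * X - 1) / exp (saddle n))))
     = Re (\<Sum>k\<le>d. of_real (real (d choose k) * X ^ k) * (peak_integral k (d - k) n / peak_integral 0 0 n))"
    by (rule arg_cong)
  have Re_mult: "Re (of_real r * z) = r * Re z" for r z
    by simp
  show ?thesis
    using eq unfolding Re_complex_of_real Re_sum Re_mult by (simp only: mult_ac)
qed

lemma peak_size_nonzero: "peak_size n \<noteq> 0"
  using \<beta> saddle_pos[of n] by (simp add: peak_size_def)

lemma peak_ratio_lim:
  "(\<lambda>n. Re (peak_integral k p n / peak_integral 0 0 n)) \<longlonglongrightarrow> hermite p 0"
proof -
  have "(\<lambda>n. (peak_integral k p n / peak_size n) / (peak_integral 0 0 n / peak_size n))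
      \<longlonglongrightarrow> of_real (2 * sqrt pi * hermite p 0) / of_real (2 * sqrt pi * hermite 0 0)"
    by (intro tendsto_divide peak_integral_lim) (simp add: hermite_0_0)
  then have "(\<lambda>n. peak_integral k p n / peak_integral 0 0 n) \<longlonglongrightarrow> of_real (hermite p 0)"
    using peak_size_nonzero by (simp add: hermite_0_0)
  from tendsto_Re[OF this] show ?thesis
    by simp
qed

lemma eventually_nonzero: "\<forall>\<^sub>F n in sequentially. C n \<noteq> 0"
proof -
  have "\<forall>\<^sub>F n in sequentially. peak_integral 0 0 n / peak_size n \<noteq> 0"
    by (rule tendsto_imp_eventually_ne[OF peak_integral_lim]) (simp add: hermite_0_0)
  then show ?thesis
    using eventually_gt_at_top[of 0]
  proof eventually_elim
    case (elim n)
    have "2 * of_real pi * of_real (C n) = of_real (width n) * peak_integral 0 0 n"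
      using jensen_poly_peak_integrals[of n 0 0] elim by (simp add: poly_jensen_poly)
    then show ?case
      using elim width_pos[of n] by auto
  qed
qed

lemma uniform_limit_hermite:
  assumes "bounded S"
  shows "uniform_limit S
     (\<lambda>n X. width n powi (- int d) / C n * poly (jensen_poly C d n) ((width n * X - 1) / exp (saddle n)))
     (hermite d) sequentially"
proof -
  have "uniform_limit S (\<lambda>n X. \<Sum>k\<le>d. real (d choose k) * Re (peak_integral k (d - k) n / peak_integral 0 0 n) * X ^ k)
     (\<lambda>X. \<Sum>k\<le>d. real (d choose k) * hermite (d - k) 0 * X ^ k) sequentially"
    by (intro uniform_limit_of_coeffs tendsto_intros peak_ratio_lim assms)
  moreover have "\<forall>\<^sub>F n in sequentially. \<forall>X\<in>S.
     (\<Sum>k\<le>d. real (d choose k) * Re (peak_integral k (d - k) n / peak_integral 0 0 n) * X ^ k)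
     = width n powi (- int d) / C n * poly (jensen_poly C d n) ((width n * X - 1) / exp (saddle n))"
    using eventually_gt_at_top[of 0] by eventually_elim (blast intro: normalised_jensen_poly[symmetric])
  ultimately show ?thesis
    by (subst (asm) uniform_limit_cong) (auto simp: hermite_binomial[symmetric])
qed

lemma eventually_hyperbolic: "\<forall>\<^sub>F n in sequentially. hyperbolic (jensen_poly C d n)"
proof -
  define f where "f n X = width n powi (- int d) / C n * poly (jensen_poly C d n) ((width n * X - 1) / exp (saddle n))" for n X
  have "\<forall>\<^sub>F n in sequentially. \<exists>R. finite R \<and> card R = card {x :: real. poly (hermite_poly d) x = 0}
      \<and> (\<forall>x\<in>R. f n x = 0)"
  proof (rule sign_changes_imp_many_roots)
    show "continuous_on UNIV (f n)" for n
      unfolding f_def[abs_def] by (intro continuous_intros) auto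
    show "(\<lambda>n. f n x) \<longlonglongrightarrow> poly (hermite_poly d) x" for x
      using tendsto_uniform_limitI[OF uniform_limit_hermite[of "{x}" d], of x] by (simp add: f_def hermite_eq_poly)
  qed (rule hermite_poly_simple_root)
  then show ?thesis
    using eventually_nonzero
  proof eventually_elim
    case (elim n)
    define \<phi> where "\<phi> X = (width n * X - 1) / exp (saddle n)" for X
    obtain R where R: "finite R" "card R = d" "\<And>x. x \<in> R \<Longrightarrow> f n x = 0"
      using elim card_hermite_roots[of d] by (auto simp: hermite_eq_poly)
    show ?case
    proof (rule hyperbolicI[OF degree_jensen_poly])
      have "poly (jensen_poly C d n) 0 = (\<Sum>j\<le>d. if j = 0 then C n else 0)"
        unfolding poly_jensen_poly by (intro sum.cong) auto
      then show "jensen_poly C d n \<noteq> 0"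
        using elim by auto
      have "inj_on \<phi> R"
        using width_pos[of n] by (auto simp: inj_on_def \<phi>_def)
      then show "card (\<phi> ` R) = d"
        using R by (simp add: card_image)
      show "finite (\<phi> ` R)"
        using R by simp
      show "poly (jensen_poly C d n) x = 0" if "x \<in> \<phi> ` R" for x
        using that R(3) elim width_pos[of n] by (auto simp: f_def \<phi>_def)
    qed
  qed
qed

end

section \<open>Rotation invariant power series on the slit disc\<close>

lemma slit_disc_eq: "slit_disc = ball 0 1 - \<real>\<^sub>\<le>\<^sub>0"
proof (intro equalityI subsetI)
  fix q assume "q \<in> slit_disc"
  then obtain z where z: "q = exp (- z)" "Re z > 0" "\<bar>Im z\<bar> < pi"
    by (auto simp: slit_disc_def)
  have "Ln q = - z"
    unfolding z(1) by (rule Ln_exp) (use z in auto)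
  then have "Im (Ln q) \<noteq> pi"
    using z by auto
  moreover have "q \<noteq> 0"
    using z by simp
  ultimately have "q \<notin> \<real>\<^sub>\<le>\<^sub>0"
    using Im_Ln_eq_pi[of q] by (auto simp: complex_nonpos_Reals_iff complex_eq_iff order.order_iff_strict)
  then show "q \<in> ball 0 1 - \<real>\<^sub>\<le>\<^sub>0"
    using z by (simp add: norm_exp_eq_Re)
next
  fix q :: complex assume q: "q \<in> ball 0 1 - \<real>\<^sub>\<le>\<^sub>0"
  then have nz: "q \<noteq> 0"
    by auto
  have "Re (- Ln q) > 0"
    using q nz by (simp add: ln_less_zero_iff)
  moreover have "\<bar>Im (- Ln q)\<bar> < pi"
    using q mpi_less_Im_Ln[OF nz] Im_Ln_less_pi[of q] by auto
  moreover have "q = exp (- (- Ln q))"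
    using nz by simp
  ultimately show "q \<in> slit_disc"
    unfolding slit_disc_def by blast
qed

lemma open_slit_disc: "open slit_disc"
  unfolding slit_disc_eq by (intro open_Diff open_ball closed_nonpos_Reals_complex)

lemma connected_slit_disc: "connected slit_disc"
proof -
  have "convex ({z. Re z > 0} \<inter> {z. Im z < pi} \<inter> {z. Im z > - pi})"
    by (intro convex_Int convex_halfspace_Re_gt convex_halfspace_Im_lt convex_halfspace_Im_gt)
  also have "{z. Re z > 0} \<inter> {z. Im z < pi} \<inter> {z. Im z > - pi} = {z. Re z > 0 \<and> \<bar>Im z\<bar> < pi}"
    by auto
  finally show ?thesis
    unfolding slit_disc_def by (intro connected_continuous_image convex_connected continuous_intros)
qed

text \<open>
  Convergence at real points arbitrarily close to \<open>1\<close> forces radius of convergence at least \<open>1\<close>, and the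
  identity with \<open>F\<close> spreads from a neighbourhood of \<open>1\<close> over the connected slit disc.
\<close>
lemma expansion_on_slit_disc:
  fixes F :: "complex \<Rightarrow> complex"
  assumes "F analytic_on slit_disc"
    and expansion: "\<forall>\<^sub>F q in at 1 within ball 0 1. (\<lambda>n. c n * q ^ n) sums F q"
  shows "\<And>q. q \<in> ball 0 1 \<Longrightarrow> summable (\<lambda>n. c n * q ^ n)"
    and "\<And>q. q \<in> slit_disc \<Longrightarrow> (\<lambda>n. c n * q ^ n) sums F q"
proof -
  obtain r where r: "r > 0" "\<And>q. q \<in> ball 0 1 \<Longrightarrow> q \<noteq> 1 \<Longrightarrow> dist q 1 < r \<Longrightarrow> (\<lambda>n. c n * q ^ n) sums F q"
    using expansion unfolding eventually_at by auto
  have dist_1: "dist (complex_of_real t) 1 = 1 - t" if "t < 1" for t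
    using that dist_of_real[of t 1, where 'a = complex] by (simp add: dist_real_def)
  have near: "(\<lambda>n. c n * of_real t ^ n) sums F (of_real t)" if "0 < t" "1 - r < t" "t < 1" for t
    by (rule r(2)) (use that dist_1 in auto)
  show summable: "summable (\<lambda>n. c n * q ^ n)" if "q \<in> ball 0 1" for q
  proof -
    have "max (norm q) (1 - r) < 1"
      using that r by simp
    then obtain t where t: "norm q < t" "1 - r < t" "t < 1"
      using dense by (metis max_less_iff_conj)
    then have "t > 0"
      using norm_ge_zero le_less_trans by blast
    then have "summable (\<lambda>n. c n * of_real t ^ n)"
      using near t by (blast intro: sums_summable)
    then have "summable (\<lambda>n. norm (c n * q ^ n))"
      by (rule powser_insidea) (use t \<open>t > 0\<close> in simp)
    then show ?thesis
      by (rule summable_norm_cancel)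
  qed
  define f where "f q = (\<Sum>n. c n * q ^ n)" for q
  have f: "f holomorphic_on ball 0 1"
  proof (rule power_series_holomorphic)
    show "(\<lambda>n. c n * (q - 0) ^ n) sums f q" if "q \<in> ball 0 1" for q
      unfolding f_def using summable_sums[OF summable[OF that]] by simp
  qed
  have "f q = F q" if "q \<in> slit_disc" for q
  proof (rule analytic_continuation_open[where s = "slit_disc \<inter> ball 1 r" and s' = slit_disc and f = f and g = F])
    have "max 0 (1 - r) < 1"
      using r by simp
    then obtain t where t: "0 < t" "1 - r < t" "t < 1"
      using dense by (metis max_less_iff_conj)
    then have "complex_of_real t \<in> slit_disc \<inter> ball 1 r"
      using dist_1[of t] by (simp add: slit_disc_eq dist_commute complex_nonpos_Reals_iff)
    then show "slit_disc \<inter> ball 1 r \<noteq> {}"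
      by blast
    show "f holomorphic_on slit_disc"
      by (rule holomorphic_on_subset[OF f]) (auto simp: slit_disc_eq)
    show "F holomorphic_on slit_disc"
      using assms(1) by (rule analytic_imp_holomorphic)
    show "f w = F w" if "w \<in> slit_disc \<inter> ball 1 r" for w
    proof -
      have "norm w < 1" "dist w 1 < r"
        using that by (auto simp: slit_disc_eq dist_commute)
      moreover from this have "w \<noteq> 1"
        by auto
      ultimately show ?thesis
        using r(2)[of w] by (simp add: f_def sums_iff)
    qed
  qed (use that in \<open>auto intro: open_Int open_slit_disc connected_slit_disc\<close>)
  then show "(\<lambda>n. c n * q ^ n) sums F q" if "q \<in> slit_disc" for q
    using that summable_sums[OF summable[of q]] by (simp add: f_def slit_disc_eq)
qed

text \<open>
  The difference of the sums at \<open>\<zeta> q\<close> and \<open>q\<close> has the coefficients \<open>c\<^sub>n (\<zeta>\<^sup>n - 1)\<close>. It vanishes where both points avoid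
  the slit, hence on the whole disc, hence coefficientwise.
\<close>
lemma coefficients_of_rotation_invariant_series:
  fixes F :: "complex \<Rightarrow> complex"
  assumes K: "K > 0"
    and conv: "\<And>q. q \<in> ball 0 1 \<Longrightarrow> summable (\<lambda>n. c n * q ^ n)"
    and sums: "\<And>q. q \<in> slit_disc \<Longrightarrow> (\<lambda>n. c n * q ^ n) sums F q"
    and symmetry: "\<And>q. q \<in> slit_disc \<Longrightarrow> exp (2 * of_real pi * \<i> / of_nat K) * q \<in> slit_disc \<Longrightarrow>
                     F (exp (2 * of_real pi * \<i> / of_nat K) * q) = F q"
    and m: "\<not> K dvd m"
  shows "c m = 0"
proof -
  define \<zeta> where "\<zeta> = exp (2 * of_real pi * \<i> / of_nat K)"
  define f where "f q = (\<Sum>n. c n * (\<zeta> ^ n - 1) * q ^ n)" for q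
  define U where "U = slit_disc \<inter> (\<lambda>q. \<zeta> * q) -` slit_disc"
  have norm_\<zeta>: "norm \<zeta> = 1"
    by (simp add: \<zeta>_def norm_exp_eq_Re)
  have K2: "K \<ge> 2"
    using K m by (cases "K = 1") auto
  have f_sums: "(\<lambda>n. c n * (\<zeta> ^ n - 1) * q ^ n) sums f q" if "q \<in> ball 0 1" for q
  proof -
    have "summable (\<lambda>n. c n * (\<zeta> * q) ^ n - c n * q ^ n)"
      using that norm_\<zeta> by (intro summable_diff conv) (auto simp: norm_mult)
    then show ?thesis
      unfolding f_def by (intro summable_sums) (simp add: power_mult_distrib algebra_simps)
  qed
  have f: "f holomorphic_on ball 0 1"
    by (rule power_series_holomorphic) (use f_sums in simp)
  have f_0: "f q = 0" if "q \<in> ball 0 1" for q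
  proof (rule analytic_continuation_open[where s = U and s' = "ball 0 1" and f = f and g = "\<lambda>_. 0"])
    show "open U"
      unfolding U_def by (intro open_Int open_slit_disc open_vimage continuous_intros)
    \<comment> \<open>rotation by \<open>2 \<pi>/K\<close> takes this point to its complex conjugate, and \<open>\<pi>/K < \<pi>\<close> for \<open>K \<ge> 2\<close>\<close>
    define q where "q = exp (- Complex 1 (pi / K))"
    have "pi / K < pi"
      using K2 by (simp add: field_simps)
    then have "q \<in> slit_disc"
      unfolding slit_disc_def q_def by (intro imageI) auto
    moreover have "\<zeta> * q = exp (- Complex 1 (- pi / K))"
      unfolding \<zeta>_def q_def exp_add[symmetric] by (intro arg_cong[of _ _ exp]) (simp add: complex_eq_iff)
    then have "\<zeta> * q \<in> slit_disc"
      using \<open>pi / K < pi\<close> unfolding slit_disc_def by (auto intro!: imageI)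
    ultimately show "U \<noteq> {}"
      by (auto simp: U_def)
    show "f w = 0" if "w \<in> U" for w
    proof -
      have w: "w \<in> slit_disc" "\<zeta> * w \<in> slit_disc"
        using that by (auto simp: U_def)
      have "(\<lambda>n. c n * (\<zeta> * w) ^ n - c n * w ^ n) sums (F (\<zeta> * w) - F w)"
        using w by (intro sums_diff sums)
      also have "F (\<zeta> * w) - F w = 0"
        using symmetry w by (simp add: \<zeta>_def)
      finally show ?thesis
        by (simp add: f_def sums_iff power_mult_distrib algebra_simps)
    qed
  qed (use f that in \<open>auto simp: U_def slit_disc_eq\<close>)
  have "f has_fps_expansion Abs_fps (\<lambda>n. c n * (\<zeta> ^ n - 1))"
  proof (rule has_fps_expansionI)
    have "\<forall>\<^sub>F u in nhds 0. u \<in> ball (0 :: complex) 1"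
      by (rule eventually_nhds_in_open) auto
    then show "\<forall>\<^sub>F u in nhds 0. (\<lambda>n. fps_nth (Abs_fps (\<lambda>n. c n * (\<zeta> ^ n - 1))) n * u ^ n) sums f u"
      by eventually_elim (use f_sums in simp)
  qed
  moreover have "f has_fps_expansion 0"
  proof (rule has_fps_expansionI)
    have "\<forall>\<^sub>F u in nhds 0. u \<in> ball (0 :: complex) 1"
      by (rule eventually_nhds_in_open) auto
    then show "\<forall>\<^sub>F u in nhds 0. (\<lambda>n. fps_nth 0 n * u ^ n) sums f u"
      by eventually_elim (use f_0 in simp)
  qed
  ultimately have "Abs_fps (\<lambda>n. c n * (\<zeta> ^ n - 1)) = 0"
    by (rule fps_expansion_unique_complex)
  then have "c m * (\<zeta> ^ m - 1) = 0"
    by (metis fps_nth_Abs_fps fps_zero_nth)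
  moreover have "\<zeta> ^ m \<noteq> 1"
    using complex_root_unity_eq_1[of K m] K m by (simp add: \<zeta>_def exp_of_nat_mult[symmetric] mult_ac)
  ultimately show ?thesis
    by simp
qed

section \<open>Convergence of the Jensen polynomials\<close>

text \<open>
  If \<open>\<alpha>\<^sub>k\<close> is the first nonzero coefficient, the remainder is \<open>O(\<bar>z\<bar>\<^sup>N)\<close> with \<open>N > k\<close> and is negligible after
  division by \<open>z\<^sup>k\<close>.
\<close>
lemma leading_term_in_cone:
  fixes F E :: "complex \<Rightarrow> complex"
  assumes E: "(\<lambda>z. norm (E z)) \<in> O[at 0 within S](\<lambda>z. norm z ^ N)"
    and expand: "\<forall>\<^sub>F z in at 0 within S.
              F z = z powr of_real B * exp (of_real A / z) * ((\<Sum>j<N. \<alpha> j * z ^ j) + E z)"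
    and k: "k < N" "\<And>j. j < k \<Longrightarrow> \<alpha> j = 0"
  shows "((\<lambda>z. F z / (z powr of_real (B + k) * exp (of_real A / z))) \<longlongrightarrow> \<alpha> k) (at 0 within S)"
proof -
  obtain c where c: "\<forall>\<^sub>F z in at 0 within S. norm (E z) \<le> c * norm z ^ N"
    using E by (elim landau_o.bigE) auto
  have id: "((\<lambda>z. z) \<longlongrightarrow> 0) (at (0 :: complex) within S)"
    by (rule tendsto_ident_at)
  have "((\<lambda>z. c * norm z ^ (N - k)) \<longlongrightarrow> c * norm (0 :: complex) ^ (N - k)) (at 0 within S)"
    by (intro tendsto_intros id)
  then have "((\<lambda>z. c * norm z ^ (N - k)) \<longlongrightarrow> 0) (at (0 :: complex) within S)"
    using k by (simp add: power_0_left)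
  moreover have "\<forall>\<^sub>F z in at 0 within S. norm (E z / z ^ k) \<le> c * norm z ^ (N - k)"
    using c eventually_neq_at_within[of 0 0 S]
  proof eventually_elim
    case (elim z)
    have "norm z ^ N = norm z ^ (N - k) * norm z ^ k"
      using k by (simp flip: power_add)
    then show ?case
      using elim by (simp add: norm_divide norm_power field_simps)
  qed
  ultimately have E_lim: "((\<lambda>z. E z / z ^ k) \<longlongrightarrow> 0) (at 0 within S)"
    by (rule Lim_null_comparison[rotated])
  have "((\<lambda>z. (\<Sum>j\<in>{k..<N}. \<alpha> j * z ^ (j - k)) + E z / z ^ k) \<longlongrightarrow> (\<Sum>j\<in>{k..<N}. \<alpha> j * 0 ^ (j - k)) + 0) (at 0 within S)"
    by (intro tendsto_intros id E_lim)
  also have "(\<Sum>j\<in>{k..<N}. \<alpha> j * 0 ^ (j - k)) = (\<Sum>j\<in>{k..<N}. if j = k then \<alpha> k else 0)"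
    by (intro sum.cong) auto
  also have "\<dots> + 0 = \<alpha> k"
    using k by simp
  finally show ?thesis
  proof (rule Lim_transform_eventually)
    show "\<forall>\<^sub>F z in at 0 within S. (\<Sum>j\<in>{k..<N}. \<alpha> j * z ^ (j - k)) + E z / z ^ k
        = F z / (z powr of_real (B + k) * exp (of_real A / z))"
      using expand eventually_neq_at_within[of 0 0 S]
    proof eventually_elim
      case (elim z)
      have "(\<Sum>j<N. \<alpha> j * z ^ j) = (\<Sum>j\<in>{k..<N}. \<alpha> j * z ^ j)"
        using k(2) by (intro sum.mono_neutral_right) auto
      also have "\<dots> = (\<Sum>j\<in>{k..<N}. z ^ k * (\<alpha> j * z ^ (j - k)))"
      proof (intro sum.cong refl)
        fix j assume "j \<in> {k..<N}"
        then have "z ^ j = z ^ k * z ^ (j - k)"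
          by (simp flip: power_add)
        then show "\<alpha> j * z ^ j = z ^ k * (\<alpha> j * z ^ (j - k))"
          by simp
      qed
      finally have sum: "(\<Sum>j<N. \<alpha> j * z ^ j) = z ^ k * (\<Sum>j\<in>{k..<N}. \<alpha> j * z ^ (j - k))"
        by (simp add: sum_distrib_left)
      have "z powr of_real (B + k) = z powr of_real B * z ^ k"
        using elim by (simp add: powr_add powr_nat')
      then show ?case
        using elim sum by (simp add: field_simps)
    qed
  qed
qed

theorem theorem1p1:
  fixes K N :: nat and M A B \<kappa> :: real
    and F :: "complex \<Rightarrow> complex" and c \<alpha> :: "nat \<Rightarrow> complex" and C :: "nat \<Rightarrow> real"
  assumes K: "K > 0" and N: "N > 0" and M: "M > 0"
    and A: "A > 0" and B: "B > 0" and \<kappa>: "\<kappa> > 0"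
    and analytic: "F analytic_on slit_disc"
    and expansion: "\<forall>\<^sub>F q in at 1 within ball 0 1. (\<lambda>n. c n * q ^ n) sums F q"
    and symmetry: "\<And>q. q \<in> slit_disc \<Longrightarrow> exp (2 * of_real pi * \<i> / of_nat K) * q \<in> slit_disc \<Longrightarrow>
                     F (exp (2 * of_real pi * \<i> / of_nat K) * q) = F q"
    and nontrivial: "\<exists>j<N. \<alpha> j \<noteq> 0"
    and major_arc: "\<exists>E :: complex \<Rightarrow> complex.
           (\<lambda>z. norm (E z)) \<in> O[at 0 within major_cone M](\<lambda>z. norm z ^ N) \<and>
           (\<forall>\<^sub>F z in at 0 within major_cone M.
              F (exp (- z)) =
                z powr of_real B * exp (of_real A / z) * ((\<Sum>j<N. \<alpha> j * z ^ j) + E z))"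
    and minor_arc: "\<exists>L::real. \<forall>\<^sub>F x in at_right 0. \<forall>y \<in> {M * x..2 * pi / real K - M * x}.
           norm (F (exp (- Complex x y))) \<le> L * exp (1 / x * (A - \<kappa>))"
    and C: "\<And>n. c (K * n) = of_real (C n)"
  shows "(\<forall>d\<ge>1. finite {n. \<not> hyperbolic (jensen_poly C d n)}) \<and>
    (\<forall>d\<ge>1. \<exists>a \<delta> :: nat \<Rightarrow> real.
       (\<forall>n. a n > 0) \<and> (\<forall>n. \<delta> n > 0) \<and> \<delta> \<longlonglongrightarrow> 0 \<and>
       (\<forall>\<^sub>F n in sequentially. C n \<noteq> 0) \<and>
       (\<forall>S. compact S \<longrightarrow>
          uniform_limit S
            (\<lambda>n X. \<delta> n powi (- int d) / C n * poly (jensen_poly C d n) ((\<delta> n * X - 1) / exp (a n)))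
            (hermite d) sequentially))"
proof -
  have K': "real K > 0"
    using K by simp
  note series = expansion_on_slit_disc[OF analytic expansion]
  define k where "k = (LEAST j. \<alpha> j \<noteq> 0)"
  have k: "k < N" "\<alpha> k \<noteq> 0" "\<And>j. j < k \<Longrightarrow> \<alpha> j = 0"
  proof -
    obtain j where j: "j < N" "\<alpha> j \<noteq> 0"
      using nontrivial by blast
    show "\<alpha> k \<noteq> 0"
      unfolding k_def by (rule LeastI[of "\<lambda>j. \<alpha> j \<noteq> 0", OF j(2)])
    have "k \<le> j"
      unfolding k_def by (rule Least_le[of "\<lambda>j. \<alpha> j \<noteq> 0", OF j(2)])
    with j show "k < N"
      by simp
    show "\<alpha> j = 0" if "j < k" for j
      using not_less_Least that unfolding k_def by blast
  qed
  define G where "G w = (\<Sum>n. c n * exp (- (w / of_nat K)) ^ n)" for w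
  obtain L where L: "\<forall>\<^sub>F x in at_right 0. \<forall>y \<in> {M * x..2 * pi / real K - M * x}.
           norm (F (exp (- Complex x y))) \<le> L * exp (1 / x * (A - \<kappa>))"
    using minor_arc by blast
  have G_F: "G w = F (exp (- (w / of_nat K)))" if "Re w > 0" "\<bar>Im w\<bar> < real K * pi" for w
  proof -
    have "exp (- (w / of_nat K)) \<in> slit_disc"
      unfolding slit_disc_def using that K' by (intro imageI) (simp add: field_simps)
    from series(2)[OF this] show ?thesis
      by (simp add: G_def sums_iff)
  qed

  \<comment> \<open>the substitution \<open>w = K z\<close> turns \<open>A/z\<close> into \<open>K A/w\<close> and \<open>z\<^sup>B\<^sup>+\<^sup>k\<close> into \<open>w\<^sup>B\<^sup>+\<^sup>k/K\<^sup>B\<^sup>+\<^sup>k\<close>\<close>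
  interpret dirichlet_saddle C G "K * A" M "K * \<kappa>" "B + k" L "\<alpha> k / of_nat K powr of_real (B + k)"
  proof
    show "(\<lambda>n. of_real (C n) * exp (- of_nat n * w)) sums G w" if "Re w > 0" for w
    proof -
      define q where "q = exp (- (w / of_nat K))"
      have "q \<in> ball 0 1"
        using that K' by (simp add: q_def norm_exp_eq_Re)
      then have "(\<lambda>n. c n * q ^ n) sums G w"
        unfolding G_def q_def by (intro summable_sums series(1))
      moreover have "strict_mono (\<lambda>n. K * n)"
        using K by (simp add: strict_mono_def)
      moreover have "c n * q ^ n = 0" if "n \<notin> range (\<lambda>n. K * n)" for n
        using that coefficients_of_rotation_invariant_series[OF K series symmetry, of n] by auto
      ultimately have "(\<lambda>n. c (K * n) * q ^ (K * n)) sums G w"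
        by (subst sums_mono_reindex)
      moreover have "q ^ (K * n) = exp (- of_nat n * w)" for n
        using K by (simp add: q_def exp_of_nat_mult[symmetric])
      ultimately show ?thesis
        by (simp add: C)
    qed
  next
    obtain E where E: "(\<lambda>z. norm (E z)) \<in> O[at 0 within major_cone M](\<lambda>z. norm z ^ N)"
      and "\<forall>\<^sub>F z in at 0 within major_cone M. F (exp (- z)) =
         z powr of_real B * exp (of_real A / z) * ((\<Sum>j<N. \<alpha> j * z ^ j) + E z)"
      using major_arc by blast
    from leading_term_in_cone[OF this k(1,3)]
    have lim: "((\<lambda>z. F (exp (- z)) / (z powr of_real (B + k) * exp (of_real A / z))) \<longlongrightarrow> \<alpha> k) (at 0 within major_cone M)" .
    have "((\<lambda>w. w / of_nat K) \<longlongrightarrow> 0 / of_nat K) (at (0 :: complex) within major_cone M)"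
      using K by (intro tendsto_intros) auto
    moreover have "\<forall>\<^sub>F w in at (0 :: complex) within major_cone M. w / of_nat K \<in> major_cone M \<and> w / of_nat K \<noteq> 0"
      unfolding eventually_at using K' by (auto simp: major_cone_def field_simps intro!: exI[of _ 1])
    ultimately have "filterlim (\<lambda>w. w / of_nat K) (at 0 within major_cone M) (at (0 :: complex) within major_cone M)"
      by (simp add: filterlim_at)
    from filterlim_compose[OF lim this]
    have "((\<lambda>w. F (exp (- (w / of_nat K))) / ((w / of_nat K) powr of_real (B + k) * exp (of_real A / (w / of_nat K)))
       / of_nat K powr of_real (B + k)) \<longlongrightarrow> \<alpha> k / of_nat K powr of_real (B + k)) (at 0 within major_cone M)"
      using K by (intro tendsto_divide tendsto_const) auto
    then show "((\<lambda>w. G w / (w powr of_real (B + k) * exp (of_real (K * A) / w)))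
       \<longlongrightarrow> \<alpha> k / of_nat K powr of_real (B + k)) (at 0 within major_cone M)"
    proof (rule Lim_transform_eventually)
      have "\<forall>\<^sub>F w in at 0 within major_cone M. w \<in> major_cone M \<and> w \<noteq> 0 \<and> norm w < real K * pi"
        unfolding eventually_at using K' by (auto intro!: exI[of _ "real K * pi"])
      then show "\<forall>\<^sub>F w in at 0 within major_cone M.
         F (exp (- (w / of_nat K))) / ((w / of_nat K) powr of_real (B + k) * exp (of_real A / (w / of_nat K)))
          / of_nat K powr of_real (B + k) = G w / (w powr of_real (B + k) * exp (of_real (K * A) / w))"
      proof eventually_elim
        case (elim w)
        have "\<bar>Im w\<bar> < real K * pi"
          using elim abs_Im_le_cmod[of w] by linarith
        then have "F (exp (- (w / of_nat K))) = G w"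
          using elim by (subst G_F) (auto simp: major_cone_def)
        moreover have "(w / of_nat K) powr of_real (B + k) * of_nat K powr of_real (B + k) = w powr of_real (B + k)"
          using powr_divide_of_real[OF K', of w "of_real (B + k)"] K by (simp add: field_simps)
        ultimately show ?case
          by (simp add: mult_ac flip: of_real_add)
      qed
    qed
  next
    have "\<forall>\<^sub>F u in at_right 0. \<forall>y \<in> {M * (u / K)..2 * pi / real K - M * (u / K)}.
           norm (F (exp (- Complex (u / K) y))) \<le> L * exp (1 / (u / K) * (A - \<kappa>))"
    proof -
      obtain r where r: "r > 0" "\<And>x. 0 < x \<Longrightarrow> x < r \<Longrightarrow> \<forall>y \<in> {M * x..2 * pi / real K - M * x}.
           norm (F (exp (- Complex x y))) \<le> L * exp (1 / x * (A - \<kappa>))"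
        using L unfolding eventually_at_right_field by blast
      show ?thesis
        unfolding eventually_at_right_field
      proof (intro exI[of _ "K * r"] conjI allI impI)
        fix u :: real assume u: "0 < u" "u < K * r"
        show "\<forall>y \<in> {M * (u / K)..2 * pi / real K - M * (u / K)}.
           norm (F (exp (- Complex (u / K) y))) \<le> L * exp (1 / (u / K) * (A - \<kappa>))"
          by (rule r(2)) (use u K' in \<open>simp_all add: field_simps\<close>)
      qed (use r K' in simp)
    qed
    moreover have "\<forall>\<^sub>F u in at_right 0. u < pi / M"
      using M unfolding eventually_at_right_field by (intro exI[of _ "pi / M"]) auto
    ultimately show "\<forall>\<^sub>F u in at_right 0. \<forall>v. M * u \<le> v \<and> v < pi \<longrightarrow>
          norm (G (Complex u v)) \<le> L * exp ((K * A - K * \<kappa>) / u)"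
      using eventually_at_right_less[of 0]
    proof eventually_elim
      case (elim u)
      show ?case
      proof (intro allI impI)
        \<comment> \<open>\<open>v < \<pi>\<close> gives \<open>v/K < \<pi>/K \<le> 2 \<pi>/K - M u/K\<close> as soon as \<open>M u \<le> \<pi>\<close>\<close>
        fix v assume v: "M * u \<le> v \<and> v < pi"
        have "M * u < pi"
          using elim M by (simp add: field_simps)
        then have "v / K \<in> {M * (u / K)..2 * pi / real K - M * (u / K)}"
          using v K' by (simp add: field_simps)
        then have le: "norm (F (exp (- Complex (u / K) (v / K)))) \<le> L * exp (1 / (u / K) * (A - \<kappa>))"
          using elim by blast
        have G: "G (Complex u v) = F (exp (- Complex (u / K) (v / K)))"
        proof -
          have "0 < M * u"
            using elim M by simp
          moreover have "pi \<le> K * pi"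
            using K by simp
          ultimately have "\<bar>v\<bar> < K * pi"
            using v by linarith
          moreover have "Complex u v / of_nat K = Complex (u / K) (v / K)"
            by (simp add: complex_eq_iff Re_divide_of_nat Im_divide_of_nat)
          ultimately show ?thesis
            using G_F[of "Complex u v"] elim by simp
        qed
        have "1 / (u / K) * (A - \<kappa>) = (K * A - K * \<kappa>) / u"
          using K' by (simp add: algebra_simps)
        with le show "norm (G (Complex u v)) \<le> L * exp ((K * A - K * \<kappa>) / u)"
          unfolding G by metis
      qed
    qed
  qed (use A B M \<kappa> K' k in auto)

  have "finite {n. \<not> hyperbolic (jensen_poly C d n)}" for d
    using eventually_hyperbolic[of d] by (simp add: cofinite_eq_sequentially[symmetric] eventually_cofinite)
  moreover have "\<exists>a \<delta> :: nat \<Rightarrow> real.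
       (\<forall>n. a n > 0) \<and> (\<forall>n. \<delta> n > 0) \<and> \<delta> \<longlonglongrightarrow> 0 \<and>
       (\<forall>\<^sub>F n in sequentially. C n \<noteq> 0) \<and>
       (\<forall>S. compact S \<longrightarrow>
          uniform_limit S
            (\<lambda>n X. \<delta> n powi (- int d) / C n * poly (jensen_poly C d n) ((\<delta> n * X - 1) / exp (a n)))
            (hermite d) sequentially)" for d
    by (intro exI[of _ saddle] exI[of _ width] conjI allI impI saddle_pos width_pos width_lim
          eventually_nonzero uniform_limit_hermite compact_imp_bounded)
  ultimately show ?thesis
    by blast
qed

end
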